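(* Assume that $\int_0^\infty x^2\,\mu(\mathrm{d}x)<\infty$. Then there exist a constant $\theta=\theta(\mu)>0$ and an increasing function $r_0:[0,\infty)\to[0,\infty)$ such that, for every $\lambda\ge0$, the following are equivalent: (i) there exists $r\ge r_0(\lambda)$ such that $\mathbb{P}_\lambda(\mathrm{Cross}(3r,r))>1-\theta$; (ii) $\lim_{r\to\infty}\mathbb{P}_\lambda(\mathrm{Cross}(3r,r))=1$. Under the stronger condition $\int_0^\infty x^2\log x\,\mu(\mathrm{d}x)<\infty$, if either of (i) or (ii) holds, then (iii) $\sum_{k\ge0}\big[1-\mathbb{P}_\lambda(\mathrm{Cross}(3^{k+1},3^k))\big]<\infty$. These statements remain valid with $\mathrm{Cross}$ replaced by $\mathrm{Cross}^\star$.
   Context: Poisson Boolean percolation: $\mu$ is a probability measure on $\mathbb{R}_+=[0,\infty)$. For $\lambda\ge 0$, $\mathbb{P}_\lambda$ is the law of a Poisson point process $\omega$ on $\mathbb{R}^2\times\mathbb{R}_+$ with intensity measure $\lambda\,\mathrm{d}x\,\mu(\mathrm{d}z)$. The occupied set is $\mathcal{O}=\bigcup_{(x,z)\in\omega}B(x,z)$, where $B(x,z)$ is the closed Euclidean disc with center $x$ and radius $z$; the vacant set is $\mathcal{V}=\mathbb{R}^2\setminus\mathcal{O}$. For $r,h>0$, $\mathrm{Cross}(r,h)$ (respectively $\mathrm{Cross}^\star(r,h)$) is the event that there is a path contained in $\mathcal{O}\cap([0,r]\times[0,h])$ (respectively $\mathcal{V}\cap([0,r]\times[0,h])$) connecting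 $\{0\}\times[0,h]$ to $\{r\}\times[0,h]$. "Increasing" is meant in the weak sense (non-decreasing). *)

theory Defs
  imports "HOL-Probability.Probability"
begin

text \<open>Not \<^const>\<open>card\<close>, which would count infinitely many points as 0.\<close>
definition num_points :: "'a set \<Rightarrow> 'a set \<Rightarrow> ennreal" where
  "num_points A \<omega> = emeasure (count_space UNIV) (\<omega> \<inter> A)"

definition configs :: "'a::metric_space set \<Rightarrow> 'a set set" where
  "configs X = {\<omega>. \<omega> \<subseteq> X \<and> (\<forall>B. bounded B \<longrightarrow> finite (\<omega> \<inter> B))}"

definition config_space :: "'a::metric_space measure \<Rightarrow> 'a set measure" where
  "config_space \<Lambda> = sigma (configs (space \<Lambda>))
     {{\<omega> \<in> configs (space \<Lambda>). num_points A \<omega> \<in> E} | A E. A \<in> sets \<Lambda> \<and> E \<in> sets borel}"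

text \<open>
  \<open>poisson_law \<Lambda> P\<close>: \<open>P\<close> is the law of a Poisson point process with intensity measure \<open>\<Lambda>\<close>.
  Configurations are encoded as point sets rather than counting measures. This is adequate
  for diffuse \<open>\<Lambda>\<close>, where the process has almost surely no multiple points; every intensity
  of the form \<open>intensity lam mu\<close> below is diffuse.
\<close>
definition poisson_law :: "'a::metric_space measure \<Rightarrow> 'a set measure \<Rightarrow> bool" where
  "poisson_law \<Lambda> P \<longleftrightarrow>
     prob_space P \<and>
     sets P = sets (config_space \<Lambda>) \<and>
     (\<forall>A \<in> sets \<Lambda>. emeasure \<Lambda> A < \<infinity> \<longrightarrow>
        (\<forall>n::nat. measure P {\<omega> \<in> space P. num_points A \<omega> = of_nat n}
                  = exp (- measure \<Lambda> A) * measure \<Lambda> A ^ n / fact n)) \<and>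
     (\<forall>A :: nat \<Rightarrow> 'a set. range A \<subseteq> sets \<Lambda> \<longrightarrow> disjoint_family A \<longrightarrow>
        prob_space.indep_vars P (\<lambda>_. borel) (\<lambda>i. num_points (A i)) UNIV)"

type_synonym plane = "real \<times> real"

definition intensity :: "real \<Rightarrow> real measure \<Rightarrow> (plane \<times> real) measure" where
  "intensity lam mu = scale_measure (ennreal lam) (lborel \<Otimes>\<^sub>M mu)"

definition occupied :: "(plane \<times> real) set \<Rightarrow> plane set" where
  "occupied \<omega> = (\<Union>(x, z) \<in> \<omega>. cball x z)"

definition vacant :: "(plane \<times> real) set \<Rightarrow> plane set" where
  "vacant \<omega> = - occupied \<omega>"

definition crossed :: "plane set \<Rightarrow> real \<Rightarrow> real \<Rightarrow> bool" where
  "crossed S r h \<longleftrightarrow> (\<exists>g. path g \<and> path_image g \<subseteq> S \<inter> ({0..r} \<times> {0..h}) \<and>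
     pathstart g \<in> {0} \<times> {0..h} \<and> pathfinish g \<in> {r} \<times> {0..h})"

definition Cross :: "real \<Rightarrow> real \<Rightarrow> (plane \<times> real) set set" where
  "Cross r h = {\<omega>. crossed (occupied \<omega>) r h}"

definition Cross_star :: "real \<Rightarrow> real \<Rightarrow> (plane \<times> real) set set" where
  "Cross_star r h = {\<omega>. crossed (vacant \<omega>) r h}"

text \<open>
  The completion matters: the crossing events are measurable in terms of the point counts
  only on the almost sure event that finitely many discs meet the rectangle, and
  \<^const>\<open>measure\<close> is 0 on non-measurable sets.
\<close>
definition Pr :: "(plane \<times> real) set measure \<Rightarrow> (plane \<times> real) set set \<Rightarrow> real" where
  "Pr P E = measure (completion P) (E \<inter> space P)"

end

(*
Renormalization. Let f(r) be the probability that the 3r x r rectangle is not crossed. Gluing four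
overlapping long crossings along vertical crossings of the three squares in which they overlap
crosses a 9r x r strip, so a strip fails with probability at most 7 f(r). If the 9r x 3r rectangle is not crossed, then neither
are its bottom and top strips. Once the discs touching both strips are discarded, these two events
are independent; discarding costs at most the expected number e(r) of such discs, which is
lambda times a tail of the second moment of mu. Hence f(3r) <= (7 f(r) + e(r))^2 + e(r). Once
f(r) <= 1/200 and e <= 1/800 beyond r, this reads f(3r) <= f(r)/2 + 2 e(r), which forces f to 0, and
the sum of e(3^k) converges under the logarithmic moment condition.

Of the Poisson law only the probabilities of void events (no point in B) are used: these events
are stable under intersection, so they determine the law on the sigma-algebra they generate, which
gives independence over disjoint regions and invariance under isometries. Vacant crossings and
occupied non-crossings are decreasing and open in the finite configuration of discs touching the
rectangle, so that up to a null set they are countable unions of void events.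
*)
theory Submission
  imports Defs "HOL-Analysis.Fashoda_Theorem"
begin

section \<open>Crossings of rectangles\<close>

definition hcross :: "plane set \<Rightarrow> real \<Rightarrow> real \<Rightarrow> real \<Rightarrow> real \<Rightarrow> bool" where
  "hcross S a b c d \<longleftrightarrow> (\<exists>g. path g \<and> path_image g \<subseteq> S \<inter> ({a..b} \<times> {c..d}) \<and>
     fst (pathstart g) = a \<and> fst (pathfinish g) = b)"

text \<open>Defined through the reflection of the plane in the diagonal, so that facts about
  horizontal crossings, including their probabilities, transfer without a second proof.\<close>

definition vcross :: "plane set \<Rightarrow> real \<Rightarrow> real \<Rightarrow> real \<Rightarrow> real \<Rightarrow> bool" where
  "vcross S a b c d \<longleftrightarrow> hcross (prod.swap ` S) c d a b"

lemma crossed_eq_hcross: "crossed S r h \<longleftrightarrow> hcross S 0 r 0 h"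
proof
  assume "crossed S r h"
  then show "hcross S 0 r 0 h"
    unfolding crossed_def hcross_def by (auto simp: mem_Times_iff)
next
  assume "hcross S 0 r 0 h"
  then obtain g where g: "path g" "path_image g \<subseteq> S \<inter> ({0..r} \<times> {0..h})"
     "fst (pathstart g) = 0" "fst (pathfinish g) = r"
    unfolding hcross_def by blast
  have "pathstart g \<in> {0..r} \<times> {0..h}" "pathfinish g \<in> {0..r} \<times> {0..h}"
    using g(2) pathstart_in_path_image[of g] pathfinish_in_path_image[of g] by blast+
  then have "pathstart g \<in> {0} \<times> {0..h}" "pathfinish g \<in> {r} \<times> {0..h}"
    using g(3,4) by (auto simp: mem_Times_iff)
  then show "crossed S r h"
    unfolding crossed_def using g(1,2) by (intro exI[of _ g]) simp
qed

lemma hcross_mono: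
  assumes "hcross S a b c d" "S \<inter> ({a..b} \<times> {c..d}) \<subseteq> T" "c' \<le> c" "d \<le> d'"
  shows "hcross T a b c' d'"
proof -
  obtain g where g: "path g" "path_image g \<subseteq> S \<inter> ({a..b} \<times> {c..d})"
     "fst (pathstart g) = a" "fst (pathfinish g) = b"
    using assms(1) unfolding hcross_def by blast
  have "S \<inter> ({a..b} \<times> {c..d}) \<subseteq> T \<inter> ({a..b} \<times> {c'..d'})"
    using assms(2-4) by auto
  then show ?thesis
    unfolding hcross_def using g by blast
qed

lemma hcross_cong:
  assumes "S \<inter> ({a..b} \<times> {c..d}) = T \<inter> ({a..b} \<times> {c..d})"
  shows "hcross S a b c d \<longleftrightarrow> hcross T a b c d"
  unfolding hcross_def assms ..

text \<open>Take \<open>v\<close> to be the first time at which \<open>f\<close> reaches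
  \<open>b\<close>, and \<open>u\<close> the last time up to \<open>v\<close> at which
  \<open>f\<close> is at most \<open>a\<close>.\<close>

lemma continuous_passage:
  fixes f :: "real \<Rightarrow> real"
  assumes "continuous_on {0..1} f" "f 0 \<le> a" "a \<le> b" "b \<le> f 1"
  obtains u v where "0 \<le> u" "u \<le> v" "v \<le> 1" "f u = a" "f v = b" "\<And>t. t \<in> {u..v} \<Longrightarrow> a \<le> f t \<and> f t \<le> b"
proof -
  let ?B = "{0..1} \<inter> f -` {b..}"
  have "compact ?B"
    using continuous_closed_preimage[OF assms(1)] by (metis closed_atLeast closed_atLeastAtMost compact_Icc compact_eq_bounded_closed bounded_Int)
  moreover have "1 \<in> ?B" using assms(4) by auto
  ultimately obtain v where v: "v \<in> ?B" "\<And>t. t \<in> ?B \<Longrightarrow> v \<le> t"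
    using compact_attains_inf[of ?B] by blast
  have v01: "0 \<le> v" "v \<le> 1" "b \<le> f v" using v(1) by auto
  have cv: "continuous_on {0..v} f"
    using assms(1) by (rule continuous_on_subset) (use v01 in auto)
  obtain t where "0 \<le> t" "t \<le> v" "f t = b"
    using IVT'[of f 0 b v] cv assms v01 by auto
  then have fv: "f v = b" using v(2)[of t] v01 by auto
  have lt_b: "f t < b" if "0 \<le> t" "t < v" for t
    using v(2)[of t] that v01 by force
  let ?A = "{0..v} \<inter> f -` {..a}"
  have "compact ?A"
    using continuous_closed_preimage[OF cv] by (metis closed_atMost closed_atLeastAtMost compact_Icc compact_eq_bounded_closed bounded_Int)
  moreover have "0 \<in> ?A" using assms(2) v01 by auto
  ultimately obtain u where u: "u \<in> ?A" "\<And>t. t \<in> ?A \<Longrightarrow> t \<le> u"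
    using compact_attains_sup[of ?A] by blast
  have u01: "0 \<le> u" "u \<le> v" "f u \<le> a" using u(1) by auto
  have cu: "continuous_on {u..v} f"
    using cv by (rule continuous_on_subset) (use u01 in auto)
  obtain t where "u \<le> t" "t \<le> v" "f t = a"
    using IVT'[of f u a v] cu assms u01 fv by auto
  then have fu: "f u = a" using u(2)[of t] u01 by auto
  have gt_a: "a < f t" if "u < t" "t \<le> v" for t
    using u(2)[of t] that u01 by force
  have "a \<le> f t \<and> f t \<le> b" if "t \<in> {u..v}" for t
    using that lt_b[of t] gt_a[of t] fu fv u01 assms(3) by (cases "t = u"; cases "t = v") auto
  then show thesis using that[of u v] u01 v01 fu fv by auto
qed

text \<open>One passage of the first coordinate from \<open>a'\<close> to \<open>b'\<close> cuts out
  of the crossing a subpath that never leaves the narrower rectangle.\<close>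

lemma hcross_subrectangle:
  assumes "hcross S a b c d" "a \<le> a'" "a' \<le> b'" "b' \<le> b"
  shows "hcross S a' b' c d"
proof -
  obtain g where g: "path g" "path_image g \<subseteq> S \<inter> ({a..b} \<times> {c..d})"
     "fst (pathstart g) = a" "fst (pathfinish g) = b"
    using assms(1) unfolding hcross_def by blast
  have "continuous_on {0..1} (\<lambda>t. fst (g t))"
    using g(1) unfolding path_def by (intro continuous_intros)
  then obtain u v where uv: "0 \<le> u" "u \<le> v" "v \<le> 1" "fst (g u) = a'" "fst (g v) = b'"
     "\<And>t. t \<in> {u..v} \<Longrightarrow> a' \<le> fst (g t) \<and> fst (g t) \<le> b'"
    by (rule continuous_passage[of _ a' b']) (use g(3,4) assms in \<open>auto simp: pathstart_def pathfinish_def\<close>)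
  have im: "path_image (subpath u v g) = g ` {u..v}"
    using uv by (simp add: path_image_subpath)
  have "g t \<in> S \<inter> ({a'..b'} \<times> {c..d})" if "t \<in> {u..v}" for t
  proof -
    have "g t \<in> S \<inter> ({a..b} \<times> {c..d})"
      using g(2) that uv(1-3) unfolding path_image_def by (meson atLeastAtMost_iff image_eqI order_trans subsetD)
    then show ?thesis using uv(6)[OF that] by (auto simp: mem_Times_iff)
  qed
  then have "path_image (subpath u v g) \<subseteq> S \<inter> ({a'..b'} \<times> {c..d})"
    unfolding im by blast
  moreover have "path (subpath u v g)"
    using g(1) uv by (intro path_subpath) auto
  ultimately show ?thesis
    unfolding hcross_def using uv(4,5) by (intro exI[of _ "subpath u v g"]) simp
qed

section \<open>Gluing crossings with the Fashoda theorem\<close>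

text \<open>The Fashoda theorem is stated for \<open>real^2\<close>; the continuous injection
  \<open>v\<close> carries it over to pairs.\<close>

lemma fashoda_prod:
  fixes f g :: "real \<Rightarrow> real \<times> real"
  assumes "path f" "path g"
    "path_image f \<subseteq> {a..b} \<times> {c..d}" "path_image g \<subseteq> {a..b} \<times> {c..d}"
    "fst (pathstart f) = a" "fst (pathfinish f) = b"
    "snd (pathstart g) = c" "snd (pathfinish g) = d"
  shows "path_image f \<inter> path_image g \<noteq> {}"
proof -
  define v :: "real \<times> real \<Rightarrow> real^2" where "v p = (\<chi> i. if i = 1 then fst p else snd p)" for p
  have v_nth: "v p $ 1 = fst p" "v p $ 2 = snd p" for p by (simp_all add: v_def)
  have cont: "continuous_on A v" for A
    unfolding v_def
  proof (rule continuous_on_vec_lambda)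
    fix i :: 2
    show "continuous_on A (\<lambda>p. if i = 1 then fst p else snd p)"
      by (cases "i = 1") (auto intro!: continuous_intros)
  qed
  have inj: "p = q" if "v p = v q" for p q
    using that v_nth by (metis prod.expand)
  have box: "v ` ({a..b} \<times> {c..d}) \<subseteq> cbox (v (a, c)) (v (b, d))"
    by (auto simp: mem_box_cart v_nth forall_2)
  obtain z where "z \<in> path_image (v \<circ> f)" "z \<in> path_image (v \<circ> g)"
  proof (rule fashoda[of "v \<circ> f" "v \<circ> g" "v (a, c)" "v (b, d)"])
    show "path (v \<circ> f)" "path (v \<circ> g)"
      using assms(1,2) cont by (auto intro: path_continuous_image)
    show "path_image (v \<circ> f) \<subseteq> cbox (v (a, c)) (v (b, d))" "path_image (v \<circ> g) \<subseteq> cbox (v (a, c)) (v (b, d))"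
      unfolding path_image_compose using assms(3,4) box by blast+
  qed (auto simp: pathstart_compose pathfinish_compose v_nth assms)
  then show ?thesis unfolding path_image_compose using inj by blast
qed

lemma vcross_path:
  assumes "vcross S a b c d"
  obtains g where "path g" "path_image g \<subseteq> S \<inter> ({a..b} \<times> {c..d})"
     "snd (pathstart g) = c" "snd (pathfinish g) = d"
proof -
  obtain g where g: "path g" "path_image g \<subseteq> prod.swap ` S \<inter> ({c..d} \<times> {a..b})"
     "fst (pathstart g) = c" "fst (pathfinish g) = d"
    using assms unfolding vcross_def hcross_def by blast
  show thesis
  proof (rule that[of "prod.swap \<circ> g"])
    show "path (prod.swap \<circ> g)"
      by (rule path_continuous_image[OF g(1)]) (auto simp: prod.swap_def[abs_def] intro!: continuous_intros)
    show "path_image (prod.swap \<circ> g) \<subseteq> S \<inter> ({a..b} \<times> {c..d})"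
      using g(2) by (auto simp: path_image_compose)
  qed (use g(3,4) in \<open>auto simp: pathstart_compose pathfinish_compose\<close>)
qed

text \<open>The vertical crossing of the overlap joins bottom to top in both rectangles, so it meets
  both horizontal crossings. The union of the three paths is therefore path-connected.\<close>

lemma hcross_glue:
  assumes h1: "hcross S a b c d" and h2: "hcross S a' b' c d" and v: "vcross S a' b c d"
    and le: "a \<le> a'" "a' \<le> b" "b \<le> b'"
  shows "hcross S a b' c d"
proof -
  let ?R = "S \<inter> ({a..b'} \<times> {c..d})"
  obtain f where f: "path f" "path_image f \<subseteq> S \<inter> ({a..b} \<times> {c..d})"
     "fst (pathstart f) = a" "fst (pathfinish f) = b"
    using h1 unfolding hcross_def by blast
  obtain g where g: "path g" "path_image g \<subseteq> S \<inter> ({a'..b'} \<times> {c..d})"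
     "fst (pathstart g) = a'" "fst (pathfinish g) = b'"
    using h2 unfolding hcross_def by blast
  obtain w where w: "path w" "path_image w \<subseteq> S \<inter> ({a'..b} \<times> {c..d})"
     "snd (pathstart w) = c" "snd (pathfinish w) = d"
    using v by (rule vcross_path)
  have sub: "path_image f \<subseteq> ?R" "path_image g \<subseteq> ?R" "path_image w \<subseteq> ?R"
    using f(2) g(2) w(2) le by auto
  have "path_image f \<subseteq> {a..b} \<times> {c..d}" "path_image w \<subseteq> {a..b} \<times> {c..d}"
    "path_image g \<subseteq> {a'..b'} \<times> {c..d}" "path_image w \<subseteq> {a'..b'} \<times> {c..d}"
    using f(2) g(2) w(2) le by auto
  then have fw: "path_image f \<inter> path_image w \<noteq> {}" and gw: "path_image g \<inter> path_image w \<noteq> {}"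
    using fashoda_prod[of f w] fashoda_prod[of g w] f g w by auto
  have "path_connected (path_image f \<union> path_image w)"
    using fw f(1) w(1) by (intro path_connected_Un path_connected_path_image)
  then have pc: "path_connected (path_image f \<union> path_image w \<union> path_image g)"
    by (rule path_connected_Un) (use gw g(1) in \<open>auto intro: path_connected_path_image\<close>)
  have "pathstart f \<in> path_image f \<union> path_image w \<union> path_image g"
    "pathfinish g \<in> path_image f \<union> path_image w \<union> path_image g" by auto
  then obtain p where "path p" "path_image p \<subseteq> path_image f \<union> path_image w \<union> path_image g"
    "pathstart p = pathstart f" "pathfinish p = pathfinish g"
    using pc unfolding path_connected_def by blast
  then show ?thesis
    unfolding hcross_def using sub f(3) g(4) by (intro exI[of _ p]) auto
qed

lemma hcross_translate:
  "hcross ((+) (u, v) ` S) (u + a) (u + b) (v + c) (v + d) \<longleftrightarrow> hcross S a b c d"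
proof -
  have imp: "hcross ((+) (u, v) ` S) (u + a) (u + b) (v + c) (v + d)" if "hcross S a b c d" for S u v a b c d
  proof -
    obtain g where g: "path g" "path_image g \<subseteq> S \<inter> ({a..b} \<times> {c..d})"
       "fst (pathstart g) = a" "fst (pathfinish g) = b"
      using \<open>hcross S a b c d\<close> unfolding hcross_def by blast
    show ?thesis
      unfolding hcross_def
    proof (intro exI[of _ "(+) (u, v) \<circ> g"] conjI)
      show "path ((+) (u, v) \<circ> g)"
        by (rule path_continuous_image[OF g(1)]) (auto intro!: continuous_intros)
      show "path_image ((+) (u, v) \<circ> g) \<subseteq> (+) (u, v) ` S \<inter> ({u + a..u + b} \<times> {v + c..v + d})"
        using g(2) by (auto simp: path_image_compose)
    qed (use g(3,4) in \<open>auto simp: pathstart_compose pathfinish_compose\<close>)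
  qed
  have "S = (+) (- u, - v) ` (+) (u, v) ` S"
    unfolding image_image by (simp add: add.assoc[symmetric] zero_prod_def[symmetric])
  \<comment> \<open>The converse is the same implication for the inverse translation.\<close>
  with imp[of S a b c d u v] imp[of "(+) (u, v) ` S" "u + a" "u + b" "v + c" "v + d" "- u" "- v"]
  show ?thesis by auto
qed

text \<open>The four rectangles start at 0, 2r, 4r and 6r, and neighbours overlap in a square of
  side \<open>r\<close>. The vertical crossings are demanded over the height 3r, so that each is a
  reflected crossing of a 3r x r rectangle; they are then cut down to the height of the
  strip.\<close>

lemma hcross_strip:
  assumes "r > 0" and c: "c \<le> c1" "c1 + r \<le> c + 3 * r"
    and h: "\<And>i. i < 4 \<Longrightarrow> hcross S (2 * r * real i) (2 * r * real i + 3 * r) c1 (c1 + r)"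
    and v: "\<And>i. i < 3 \<Longrightarrow> vcross S (2 * r * real (Suc i)) (2 * r * real (Suc i) + r) c (c + 3 * r)"
  shows "hcross S 0 (9 * r) c1 (c1 + r)"
proof -
  have v': "vcross S (2 * r * real (Suc i)) (2 * r * real (Suc i) + r) c1 (c1 + r)" if "i < 3" for i
    using v[OF that] \<open>r > 0\<close> c unfolding vcross_def by (auto intro: hcross_subrectangle[where a = c and b = "c + 3 * r"])
  have "hcross S 0 (2 * r * real i + 3 * r) c1 (c1 + r)" if "i < 4" for i
    using that
  proof (induction i)
    case 0
    then show ?case using h[of 0] by simp
  next
    case (Suc i)
    have "hcross S 0 (2 * r * real i + 3 * r) c1 (c1 + r)" using Suc by simp
    moreover have "hcross S (2 * r * real (Suc i)) (2 * r * real (Suc i) + 3 * r) c1 (c1 + r)"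
      using Suc h by blast
    moreover have "vcross S (2 * r * real (Suc i)) (2 * r * real i + 3 * r) c1 (c1 + r)"
      using v'[of i] Suc by (simp add: algebra_simps)
    ultimately show ?case
      by (rule hcross_glue) (use \<open>r > 0\<close> in \<open>auto simp: algebra_simps\<close>)
  qed
  from this[of 3] show ?thesis by simp
qed

section \<open>Stability of crossings under perturbation of the discs\<close>

lemma occupied_mono: "\<omega> \<subseteq> \<omega>' \<Longrightarrow> occupied \<omega> \<subseteq> occupied \<omega>'"
  unfolding occupied_def by auto

text \<open>The discs that meet \<open>C\<close> form the projection, along the compact factor
  \<open>C\<close>, of a closed set, and such projections are closed.\<close>

lemma open_discs_avoiding_compact:
  fixes C :: "'a::euclidean_space set"
  assumes "compact C"
  shows "open {(x, z). cball x z \<inter> C = {}}"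
proof -
  have "closed {p :: 'a \<times> real. \<exists>y. y \<in> C \<and> (y, p) \<in> {q. dist (fst (snd q)) (fst q) \<le> snd (snd q)}}"
    by (intro closed_compact_projection assms closed_Collect_le continuous_intros)
  then have "open (- {p :: 'a \<times> real. \<exists>y. y \<in> C \<and> (y, p) \<in> {q. dist (fst (snd q)) (fst q) \<le> snd (snd q)}})"
    by (rule open_Compl)
  also have "- {p :: 'a \<times> real. \<exists>y. y \<in> C \<and> (y, p) \<in> {q. dist (fst (snd q)) (fst q) \<le> snd (snd q)}}
      = {(x, z). cball x z \<inter> C = {}}"
    by (auto simp: disjoint_iff)
  finally show ?thesis .
qed

text \<open>The crossing path is compact, so the discs that miss it form an open set, and the same
  path is a vacant crossing for all of them together.\<close>

lemma vacant_crossing_open: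
  assumes "hcross (vacant \<omega>) a b c d"
  obtains W where "open W" "\<omega> \<subseteq> W" "hcross (vacant W) a b c d"
proof -
  obtain g where g: "path g" "path_image g \<subseteq> vacant \<omega> \<inter> ({a..b} \<times> {c..d})"
     "fst (pathstart g) = a" "fst (pathfinish g) = b"
    using assms unfolding hcross_def by blast
  let ?W = "{(x, z). cball x z \<inter> path_image g = {}}"
  show thesis
  proof (rule that[of ?W])
    show "open ?W"
      using g(1) by (intro open_discs_avoiding_compact compact_path_image)
    show "\<omega> \<subseteq> ?W"
      using g(2) unfolding vacant_def occupied_def by auto
    have "path_image g \<subseteq> vacant ?W"
      unfolding vacant_def occupied_def by auto
    then show "hcross (vacant ?W) a b c d"
      unfolding hcross_def using g by (intro exI[of _ g]) auto
  qed
qed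

lemma path_component_block:
  assumes "path_connected D" "D \<subseteq> X" "p \<in> D" "path_component X q p"
  shows "D \<subseteq> path_component_set X q"
  using path_component_maximal[OF assms(3,1,2)] assms(4)
  by (metis path_component_eq mem_Collect_eq)

text \<open>A finite union of discs without a crossing splits, inside the rectangle, into two disjoint
  compact sets, one containing everything reachable from the left side. Separate these by open
  sets \<open>U\<close> and \<open>V\<close>; then any family of discs avoiding the rest of the rectangle has no crossing.\<close>
lemma occupied_noncrossing_open:
  assumes fin: "finite \<omega>" and no: "\<not> hcross (occupied \<omega>) a b c d" and "a < b"
  obtains W where "open W" "\<omega> \<subseteq> W" "\<not> hcross (occupied W) a b c d"
proof -
  define K where "K = {a..b} \<times> {c..d}"
  have compK: "compact K" unfolding K_def by (intro compact_Times compact_Icc)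
  define X where "X = occupied \<omega> \<inter> K"
  define D where "D p = cball (fst p) (snd p) \<inter> K" for p :: "plane \<times> real"
  have X_eq: "X = (\<Union>p\<in>\<omega>. D p)"
    unfolding X_def D_def occupied_def by auto
  have compD: "compact (D p)" for p
    unfolding D_def using compK by (intro compact_Int compact_cball)
  have connD: "path_connected (D p)" for p
    unfolding D_def K_def by (intro convex_imp_path_connected convex_Int convex_Times convex_cball convex_real_interval)
  define L where "L = {x. \<exists>y\<in>X. fst y = a \<and> path_component X y x}"
  have L_sub: "L \<subseteq> X"
    unfolding L_def using path_component_mem(2) by blast
  \<comment> \<open>Each \<open>D p\<close> is convex, so it lies inside \<open>L\<close> or misses
    it. Hence \<open>L\<close> and \<open>X - L\<close> are both finite unions of compact
    pieces.\<close>
  have block: "D p \<subseteq> L" if p: "p \<in> \<omega>" "D p \<inter> L \<noteq> {}" for p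
  proof -
    obtain x y where xy: "x \<in> D p" "y \<in> X" "fst y = a" "path_component X y x"
      using p(2) unfolding L_def by blast
    have "D p \<subseteq> X" using p(1) X_eq by blast
    with xy have "D p \<subseteq> path_component_set X y"
      by (intro path_component_block[of _ _ x] connD)
    then show ?thesis using xy unfolding L_def by auto
  qed
  have L_eq: "L = (\<Union>p\<in>{p\<in>\<omega>. D p \<inter> L \<noteq> {}}. D p)"
    using block L_sub X_eq by blast
  have R_eq: "X - L = (\<Union>p\<in>{p\<in>\<omega>. D p \<inter> L = {}}. D p)"
    using block X_eq by blast
  have clL: "closed L"
    by (subst L_eq) (intro closed_UN, auto simp: fin compact_imp_closed compD)
  have clR: "closed (X - L)"
    by (subst R_eq) (intro closed_UN, auto simp: fin compact_imp_closed compD)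
  have start: "x \<in> L" if "x \<in> X" "fst x = a" for x
    using that unfolding L_def by (auto simp: path_component_refl)
  have finish: "fst x \<noteq> b" if "x \<in> L" for x
  proof
    assume "fst x = b"
    obtain y where "y \<in> X" "fst y = a" "path_component X y x"
      using \<open>x \<in> L\<close> unfolding L_def by blast
    then obtain g where "path g" "path_image g \<subseteq> X" "pathstart g = y" "pathfinish g = x"
      unfolding path_component_def by blast
    then have "hcross (occupied \<omega>) a b c d"
      using \<open>fst x = b\<close> \<open>fst y = a\<close> unfolding hcross_def X_def K_def by blast
    then show False using no by simp
  qed
  have cla: "closed {x :: plane. fst x = a}" and clb: "closed {x :: plane. fst x = b}"
    by (intro closed_Collect_eq continuous_intros)+
  \<comment> \<open>A crossing in the larger occupied set may start or end outside \<open>X\<close>,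
    so the full lines over \<open>a\<close> and \<open>b\<close> are added to the two sides before
    separating.\<close>
  have "(L \<union> {x. fst x = a}) \<inter> ((X - L) \<union> {x. fst x = b}) = {}"
    using start finish \<open>a < b\<close> by auto
  then obtain U V where UV: "open U" "open V" "L \<union> {x. fst x = a} \<subseteq> U" "(X - L) \<union> {x. fst x = b} \<subseteq> V" "U \<inter> V = {}"
    using separation_normal[OF closed_Un[OF clL cla] closed_Un[OF clR clb]] by blast
  define C where "C = K - (U \<union> V)"
  have "compact C" unfolding C_def using compK UV by (intro compact_diff) auto
  let ?W = "{(x, z). cball x z \<inter> C = {}}"
  show thesis
  proof (rule that[of ?W])
    show "open ?W" using \<open>compact C\<close> by (rule open_discs_avoiding_compact)
    have "X \<inter> C = {}" unfolding C_def using UV by blast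
    then show "\<omega> \<subseteq> ?W" unfolding X_def C_def occupied_def by blast
    show "\<not> hcross (occupied ?W) a b c d"
    proof
      assume "hcross (occupied ?W) a b c d"
      then obtain g where g: "path g" "path_image g \<subseteq> occupied ?W \<inter> K"
        "fst (pathstart g) = a" "fst (pathfinish g) = b"
        unfolding hcross_def K_def by blast
      have "path_image g \<subseteq> U \<union> V"
        using g(2) unfolding C_def occupied_def by blast
      moreover have "pathstart g \<in> U \<inter> path_image g" "pathfinish g \<in> V \<inter> path_image g"
        using g(3,4) UV by auto
      ultimately show False
        using connectedD[OF connected_path_image[OF g(1)] UV(1,2)] UV(5) by blast
    qed
  qed
qed

section \<open>The intensity measure\<close>

lemma num_points_eq_0_iff: "num_points A \<omega> = 0 \<longleftrightarrow> \<omega> \<inter> A = {}"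
  by (simp add: num_points_def emeasure_count_space_eq_0)

lemma num_points_of_nat_finite: "num_points A \<omega> = of_nat n \<Longrightarrow> finite (\<omega> \<inter> A)"
  unfolding num_points_def by (metis emeasure_count_space_infinite ennreal_of_nat_neq_top infinity_ennreal_def subset_UNIV)

definition touching :: "plane set \<Rightarrow> (plane \<times> real) set" where
  "touching K = {(x, z). 0 \<le> z \<and> cball x z \<inter> K \<noteq> {}}"

lemma touchingE:
  assumes "(x, z) \<in> touching K"
  obtains y where "y \<in> K" "dist x y \<le> z"
  using assms unfolding touching_def by auto

lemma abs_coord_le:
  fixes x y :: plane
  assumes "dist x y \<le> z"
  shows "\<bar>fst x\<bar> \<le> \<bar>fst y\<bar> + z" "\<bar>snd x\<bar> \<le> \<bar>snd y\<bar> + z"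
  using dist_fst_le[of x y] dist_snd_le[of x y] assms by (auto simp: dist_real_def)

locale radius_law = mu: prob_space mu for mu :: "real measure" +
  assumes sets_mu: "sets mu = sets (restrict_space borel {0..})"
    and second_moment: "integrable mu (\<lambda>x. x^2)"
begin

lemma space_mu: "space mu = {0..}"
  using sets_eq_imp_space_eq[OF sets_mu] by (simp add: space_restrict_space)

lemma measurable_mu: "f \<in> borel_measurable borel \<Longrightarrow> f \<in> borel_measurable mu"
  unfolding measurable_cong_sets[OF sets_mu refl] by (rule measurable_restrict_space1)

lemma space_intensity: "space (intensity lam mu) = UNIV \<times> {0..}"
  by (simp add: intensity_def space_scale_measure space_pair_measure space_mu)

lemma sets_intensity: "sets (intensity lam mu) = sets (lborel \<Otimes>\<^sub>M mu)"
  by (simp add: intensity_def)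

text \<open>The identity is measurable from the product sigma-algebra to the Borel sets. This is how
  open sets of marked points become sets to which the intensity applies.\<close>

lemma borel_in_sets_intensity:
  assumes "A \<in> sets borel"
  shows "A \<inter> (UNIV \<times> {0..}) \<in> sets (intensity lam mu)"
proof -
  have "snd \<in> measurable (lborel \<Otimes>\<^sub>M mu) borel"
    by (rule measurable_compose[OF measurable_snd]) (simp add: measurable_mu)
  then have "(\<lambda>p. (fst p, snd p)) \<in> measurable (lborel \<Otimes>\<^sub>M mu) (borel \<Otimes>\<^sub>M borel)"
    by (intro measurable_Pair) (auto intro: measurable_compose[OF measurable_fst])
  then have "(\<lambda>p. p) \<in> measurable (lborel \<Otimes>\<^sub>M mu) borel"
    by (simp add: borel_prod)
  then have "(\<lambda>p. p) -` A \<inter> space (lborel \<Otimes>\<^sub>M mu) \<in> sets (lborel \<Otimes>\<^sub>M mu)"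
    using assms by (rule measurable_sets)
  then show ?thesis
    by (simp add: sets_intensity space_pair_measure space_mu)
qed

lemma emeasure_intensity:
  assumes "A \<in> sets (intensity lam mu)"
  shows "emeasure (intensity lam mu) A = ennreal lam * (\<integral>\<^sup>+z. emeasure lborel ((\<lambda>x. (x, z)) -` A) \<partial>mu)"
proof -
  interpret pair_sigma_finite "lborel :: plane measure" mu ..
  show ?thesis
    using assms unfolding intensity_def by (simp add: emeasure_pair_measure_alt2)
qed

text \<open>At a fixed radius \<open>z\<close> the centres lie in a square of side
  \<open>2 * \<rho> z\<close>, whose area is at most \<open>f z\<close>; integrate over
  \<open>mu\<close>. The bounds are asked for only where the slice is nonempty, so \<open>f\<close>
  may vanish on small radii, as it does in \<open>tail\<close>.\<close>

lemma emeasure_intensity_le: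
  assumes "A \<in> sets (intensity lam mu)" "0 \<le> lam" "integrable mu f" "\<And>z. 0 \<le> f z"
    and "\<And>x z. (x, z) \<in> A \<Longrightarrow> \<bar>fst x\<bar> \<le> \<rho> z \<and> \<bar>snd x\<bar> \<le> \<rho> z"
    and "\<And>x z. (x, z) \<in> A \<Longrightarrow> 4 * (\<rho> z)\<^sup>2 \<le> f z"
  shows "emeasure (intensity lam mu) A \<le> ennreal (lam * (\<integral>z. f z \<partial>mu))"
proof -
  have slice: "emeasure lborel ((\<lambda>x. (x, z)) -` A) \<le> ennreal (f z)" for z
  proof (cases "\<exists>x. (x, z) \<in> A")
    case False
    then have "(\<lambda>x. (x, z)) -` A = {}" by auto
    then show ?thesis by simp
  next
    case True
    then have \<rho>: "0 \<le> \<rho> z" "4 * (\<rho> z)\<^sup>2 \<le> f z" using assms(5,6) by fastforce+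
    have "(\<lambda>x. (x, z)) -` A \<subseteq> {- \<rho> z..\<rho> z} \<times> {- \<rho> z..\<rho> z}"
      using assms(5) by (fastforce simp: abs_le_iff)
    then have "emeasure lborel ((\<lambda>x. (x, z)) -` A) \<le> emeasure lborel ({- \<rho> z..\<rho> z} \<times> {- \<rho> z..\<rho> z})"
      by (rule emeasure_mono) (simp add: borel_Times)
    also have "\<dots> = emeasure (lborel \<Otimes>\<^sub>M lborel) ({- \<rho> z..\<rho> z} \<times> {- \<rho> z..\<rho> z})"
      by (simp add: lborel_prod)
    also have "\<dots> = ennreal (2 * \<rho> z) * ennreal (2 * \<rho> z)"
      using \<rho> by (subst lborel.emeasure_pair_measure_Times) auto
    also have "\<dots> = ennreal (4 * (\<rho> z)\<^sup>2)"
      using \<rho> by (simp add: ennreal_mult[symmetric] power2_eq_square)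
    also have "\<dots> \<le> ennreal (f z)" using \<rho> by (simp add: ennreal_leI)
    finally show ?thesis .
  qed
  have "emeasure (intensity lam mu) A \<le> ennreal lam * (\<integral>\<^sup>+z. ennreal (f z) \<partial>mu)"
    unfolding emeasure_intensity[OF assms(1)] by (intro mult_left_mono nn_integral_mono slice) auto
  also have "\<dots> = ennreal (lam * (\<integral>z. f z \<partial>mu))"
    using assms by (simp add: nn_integral_eq_integral ennreal_mult)
  finally show ?thesis .
qed

lemma touching_in_sets:
  assumes "compact K"
  shows "touching K \<in> sets (intensity lam mu)"
proof -
  have "- {(x, z). cball x z \<inter> K = {}} \<in> sets borel"
    using open_discs_avoiding_compact[OF assms] by auto
  from borel_in_sets_intensity[OF this] show ?thesis
    by (rule back_subst[of "\<lambda>A. A \<in> sets (intensity lam mu)"]) (auto simp: touching_def)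
qed

lemma integrable_mu_square: "integrable mu (\<lambda>z. (R + z)\<^sup>2)"
proof (rule Bochner_Integration.integrable_bound)
  show "integrable mu (\<lambda>z. 2 * R\<^sup>2 + 2 * z\<^sup>2)"
    using second_moment by simp
  show "(\<lambda>z. (R + z)\<^sup>2) \<in> borel_measurable mu"
    by (rule measurable_mu) measurable
  have "(R + z)\<^sup>2 \<le> 2 * R\<^sup>2 + 2 * z\<^sup>2" for z
    using zero_le_power2[of "R - z"] by (simp add: power2_eq_square algebra_simps)
  then show "AE z in mu. norm ((R + z)\<^sup>2) \<le> norm (2 * R\<^sup>2 + 2 * z\<^sup>2)"
    by (intro AE_I2) (simp add: abs_of_nonneg)
qed

text \<open>A disc of radius \<open>z\<close> that meets \<open>K\<close> has both centre
  coordinates at most \<open>R + z\<close> in absolute value, so the second moment bounds the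
  expected number of such discs.\<close>

lemma touching_finite:
  assumes "compact K" "0 \<le> lam"
  shows "emeasure (intensity lam mu) (touching K) < \<infinity>"
proof -
  obtain R where R: "\<And>y. y \<in> K \<Longrightarrow> norm y \<le> R"
    using compact_imp_bounded[OF assms(1)] unfolding bounded_iff by auto
  have "emeasure (intensity lam mu) (touching K) \<le> ennreal (lam * (\<integral>z. 4 * (R + z)\<^sup>2 \<partial>mu))"
  proof (rule emeasure_intensity_le[where \<rho> = "\<lambda>z. R + z"])
    fix x z assume "(x, z) \<in> touching K"
    then obtain y where y: "y \<in> K" "dist x y \<le> z" by (rule touchingE)
    then show "\<bar>fst x\<bar> \<le> R + z \<and> \<bar>snd x\<bar> \<le> R + z"
      using abs_coord_le[OF y(2)] R[OF y(1)] norm_fst_le[of "fst y" "snd y"] norm_snd_le[of "snd y" "fst y"] by simp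
  qed (use assms in \<open>auto intro: touching_in_sets integrable_mu_square integrable_mult_right\<close>)
  then show ?thesis by (simp add: le_less_trans)
qed

section \<open>The tail of the second moment\<close>

text \<open>A disc meeting two strips at distance \<open>r\<close> inside \<open>[0, 9r] \<times> [0, 3r]\<close> has radius \<open>z \<ge> r / 2\<close>
  and a centre with both coordinates at most \<open>9r + z \<le> 19z\<close> in absolute value, whence the
  constant \<open>1444 = 38\<^sup>2\<close>.\<close>
definition tail :: "real \<Rightarrow> real" where
  "tail r = (\<integral>z. 1444 * z\<^sup>2 * indicator {r / 2..} z \<partial>mu)"

lemma integrable_tail: "integrable mu (\<lambda>z. 1444 * z\<^sup>2 * indicator {r / 2..} z)"
proof (rule Bochner_Integration.integrable_bound)
  show "integrable mu (\<lambda>z. 1444 * z\<^sup>2)"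
    using second_moment by simp
  show "(\<lambda>z. 1444 * z\<^sup>2 * indicator {r / 2..} z) \<in> borel_measurable mu"
    by (rule measurable_mu) measurable
qed (auto simp: indicator_def)

lemma tail_nonneg: "0 \<le> tail r"
  unfolding tail_def by (rule Bochner_Integration.integral_nonneg) (auto simp: indicator_def)

lemma tail_antimono: "r \<le> s \<Longrightarrow> tail s \<le> tail r"
  unfolding tail_def by (intro integral_mono integrable_tail) (auto simp: indicator_def)

text \<open>Dominated convergence, with the integrable bound
  \<open>1444 * z\<^sup>2\<close>.\<close>

lemma tail_tendsto_0: "(tail \<longlongrightarrow> 0) at_top"
proof -
  have "((\<lambda>r. \<integral>z. 1444 * z\<^sup>2 * indicator {r / 2..} z \<partial>mu) \<longlongrightarrow> (\<integral>z. 0 \<partial>mu)) at_top"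
  proof (rule integral_dominated_convergence_at_top[where w = "\<lambda>z. 1444 * z\<^sup>2"])
    show "integrable mu (\<lambda>z. 1444 * z\<^sup>2)" using second_moment by simp
    show "(\<lambda>z. 1444 * z\<^sup>2 * indicator {r / 2..} z) \<in> borel_measurable mu" for r :: real
      by (rule measurable_mu) measurable
    show "\<forall>\<^sub>F r in at_top. AE z in mu. norm (1444 * z\<^sup>2 * indicator {r / 2..} z :: real) \<le> 1444 * z\<^sup>2"
      by (intro always_eventually allI AE_I2) (auto simp: indicator_def)
    have "((\<lambda>r. 1444 * z\<^sup>2 * indicator {r / 2..} z :: real) \<longlongrightarrow> 0) at_top" for z :: real
      by (rule tendsto_eventually, rule eventually_mono[OF eventually_gt_at_top[of "2 * z"]]) (auto simp: indicator_def)
    then show "AE z in mu. ((\<lambda>r. 1444 * z\<^sup>2 * indicator {r / 2..} z :: real) \<longlongrightarrow> 0) at_top"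
      by simp
  qed simp
  then show ?thesis by (simp add: tail_def[abs_def])
qed

lemma touching_both_strips_le:
  assumes "0 < r" "0 \<le> lam"
  shows "emeasure (intensity lam mu) (touching ({0..9 * r} \<times> {0..r}) \<inter> touching ({0..9 * r} \<times> {2 * r..3 * r}))
    \<le> ennreal (lam * tail r)"
  unfolding tail_def
proof (rule emeasure_intensity_le[where \<rho> = "\<lambda>z. 19 * z"])
  fix x z
  assume xz: "(x, z) \<in> touching ({0..9 * r} \<times> {0..r}) \<inter> touching ({0..9 * r} \<times> {2 * r..3 * r})"
  obtain y where y: "y \<in> {0..9 * r} \<times> {0..r}" "dist x y \<le> z" by (rule touchingE[OF IntD1[OF xz]])
  obtain y' where y': "y' \<in> {0..9 * r} \<times> {2 * r..3 * r}" "dist x y' \<le> z" by (rule touchingE[OF IntD2[OF xz]])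
  have "r \<le> dist y y'"
    using dist_snd_le[of y y'] y(1) y'(1) by (auto simp: dist_real_def)
  also have "\<dots> \<le> 2 * z"
    using dist_triangle3[of y y' x] y(2) y'(2) by simp
  finally have rz: "r \<le> 2 * z" .
  then show "\<bar>fst x\<bar> \<le> 19 * z \<and> \<bar>snd x\<bar> \<le> 19 * z"
    using abs_coord_le[OF y(2)] y(1) by auto
  show "4 * (19 * z)\<^sup>2 \<le> 1444 * z\<^sup>2 * indicator {r / 2..} z"
    using rz by (simp add: indicator_def power_mult_distrib)
next
  show "integrable mu (\<lambda>z. 1444 * z\<^sup>2 * indicator {r / 2..} z)" by (rule integrable_tail)
qed (use assms in \<open>auto intro!: sets.Int touching_in_sets compact_Times simp: indicator_def\<close>)

text \<open>Exchange sum and integral: the radius \<open>z\<close> contributes to the term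
  \<open>k\<close> only if \<open>3 ^ k \<le> 2 * z\<close>, and the number of such \<open>k\<close>
  grows at most logarithmically in \<open>z\<close>.\<close>

lemma summable_tail:
  assumes "integrable mu (\<lambda>x. x\<^sup>2 * ln x)"
  shows "summable (\<lambda>k. tail (3 ^ k))"
proof -
  define h :: "real \<Rightarrow> real" where "h z = 1444 * (3 * z\<^sup>2 + \<bar>z\<^sup>2 * ln z\<bar>)" for z
  have int_h: "integrable mu h"
    unfolding h_def using assms second_moment by (intro integrable_mult_right Bochner_Integration.integrable_add integrable_abs) auto
  have bound: "(\<Sum>k<n. 1444 * z\<^sup>2 * indicator {3 ^ k / 2..} z) \<le> h z" if "0 \<le> z" for n :: nat and z :: real
  proof (cases "2 * z < 1")
    case True
    have "2 * z < 3 ^ k" for k :: nat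
      using True one_le_power[of "3::real" k] by linarith
    then have "(\<Sum>k<n. 1444 * z\<^sup>2 * indicator {3 ^ k / 2..} z :: real) = 0"
      by (intro sum.neutral) (auto simp: indicator_def not_le divide_simps mult.commute[of z])
    then show ?thesis by (rule ord_eq_le_trans) (simp add: h_def)
  next
    case False
    define m where "m = nat \<lfloor>log 3 (2 * z)\<rfloor>"
    have log0: "0 \<le> log 3 (2 * z)" using False by simp
    have "k \<le> m" if "(3::real) ^ k \<le> 2 * z" for k
    proof -
      have "real k \<le> log 3 (2 * z)" using that False by (subst le_log_iff) (auto simp: powr_realpow)
      then show ?thesis unfolding m_def by (simp add: le_nat_floor)
    qed
    then have "indicator {3 ^ k / 2..} z \<le> (indicator {..m} k :: real)" for k
      by (auto simp: indicator_def divide_simps mult.commute)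
    then have "(\<Sum>k<n. indicator {3 ^ k / 2..} z) \<le> (\<Sum>k<n. indicator {..m} k :: real)"
      by (intro sum_mono)
    also have "\<dots> = real (card ({..<n} \<inter> Collect (\<lambda>k. k \<in> {..m})))"
      by (simp add: indicator_def sum_of_bool_eq)
    also have "\<dots> \<le> real (card {..m})"
      by (intro of_nat_mono card_mono) auto
    also have "\<dots> \<le> 1 + log 3 (2 * z)"
      using log0 unfolding m_def by simp
    \<comment> \<open>The factor 2 is absorbed by \<open>ln 2 \<le> ln 3\<close>, and
      \<open>1 \<le> ln 3\<close> removes the base 3. The absolute value covers radii between 1/2
      and 1.\<close>
    also have "\<dots> \<le> 3 + \<bar>ln z\<bar>"
    proof -
      have z: "0 < z" using False by simp
      have ln3: "1 \<le> ln (3::real)"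
        using exp_le by (subst ln_ge_iff) auto
      have "log 3 (2 * z) = (ln 2 + ln z) / ln 3" using z by (simp add: log_def ln_mult)
      also have "\<dots> \<le> (ln 3 + \<bar>ln z\<bar>) / ln 3"
        using ln3 by (intro divide_right_mono add_mono) auto
      also have "\<dots> = 1 + \<bar>ln z\<bar> / ln 3" using ln3 by (simp add: add_divide_distrib)
      also have "\<dots> \<le> 1 + \<bar>ln z\<bar> / 1" using ln3 by (intro add_left_mono divide_left_mono) auto
      finally show ?thesis by simp
    qed
    finally have "(\<Sum>k<n. indicator {3 ^ k / 2..} z) \<le> 3 + \<bar>ln z\<bar>" .
    then have "1444 * z\<^sup>2 * (\<Sum>k<n. indicator {3 ^ k / 2..} z) \<le> 1444 * z\<^sup>2 * (3 + \<bar>ln z\<bar>)"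
      by (intro mult_left_mono) auto
    then show ?thesis unfolding h_def sum_distrib_left by (simp add: algebra_simps abs_mult)
  qed
  show ?thesis
  proof (rule bounded_imp_summable)
    show "0 \<le> tail (3 ^ n)" for n by (rule tail_nonneg)
    fix n
    have "(\<Sum>k\<le>n. tail (3 ^ k)) = (\<integral>z. (\<Sum>k<Suc n. 1444 * z\<^sup>2 * indicator {3 ^ k / 2..} z) \<partial>mu)"
      unfolding tail_def lessThan_Suc_atMost by (subst Bochner_Integration.integral_sum) (auto intro: integrable_tail)
    also have "\<dots> \<le> (\<integral>z. h z \<partial>mu)"
      by (intro integral_mono Bochner_Integration.integrable_sum integrable_tail int_h bound) (simp add: space_mu)
    finally show "(\<Sum>k\<le>n. tail (3 ^ k)) \<le> (\<integral>z. h z \<partial>mu)" .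
  qed
qed

end

section \<open>Events determined by void events\<close>

locale boolean_model = radius_law mu + prob_space P
  for mu :: "real measure" and P :: "(plane \<times> real) set measure" and lam :: real +
  assumes lam_nonneg: "0 \<le> lam" and law: "poisson_law (intensity lam mu) P"
begin

abbreviation \<Lambda> :: "(plane \<times> real) measure" where "\<Lambda> \<equiv> intensity lam mu"

lemma sets_P: "sets P = sets (config_space \<Lambda>)"
  using law by (simp add: poisson_law_def)

lemma generators_subset:
  "{{\<omega> \<in> configs (space M). num_points A \<omega> \<in> E} | A E. A \<in> sets M \<and> E \<in> sets borel} \<subseteq> Pow (configs (space M))"
  by auto

lemma space_P: "space P = configs (UNIV \<times> {0..})"
proof -
  have "space P = configs (space \<Lambda>)"
    using sets_eq_imp_space_eq[OF sets_P]
    unfolding config_space_def space_measure_of[OF generators_subset] .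
  then show ?thesis by (simp add: space_intensity)
qed

lemma num_points_event:
  assumes "A \<in> sets \<Lambda>" "E \<in> sets borel"
  shows "{\<omega> \<in> space P. num_points A \<omega> \<in> E} \<in> events"
proof -
  have "{\<omega> \<in> configs (space \<Lambda>). num_points A \<omega> \<in> E}
      \<in> {{\<omega> \<in> configs (space \<Lambda>). num_points A \<omega> \<in> E} | A E. A \<in> sets \<Lambda> \<and> E \<in> sets borel}"
    using assms by blast
  then show ?thesis
    unfolding sets_P config_space_def sets_measure_of[OF generators_subset]
    by (simp add: space_P space_intensity sigma_sets.Basic)
qed

lemma prob_num_points:
  assumes "A \<in> sets \<Lambda>" "emeasure \<Lambda> A < \<infinity>"
  shows "prob {\<omega> \<in> space P. num_points A \<omega> = of_nat n} = exp (- measure \<Lambda> A) * measure \<Lambda> A ^ n / fact n"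
  using law assms by (simp add: poisson_law_def)

definition void :: "(plane \<times> real) set \<Rightarrow> (plane \<times> real) set set" where
  "void B = {\<omega> \<in> space P. \<omega> \<inter> B = {}}"

lemma void_eq: "void B = {\<omega> \<in> space P. num_points B \<omega> = of_nat 0}"
  by (simp add: void_def num_points_eq_0_iff)

lemma void_event: "B \<in> sets \<Lambda> \<Longrightarrow> void B \<in> events"
  unfolding void_eq using num_points_event[of B "{of_nat 0}"] by simp

lemma prob_void: "B \<in> sets \<Lambda> \<Longrightarrow> emeasure \<Lambda> B < \<infinity> \<Longrightarrow> prob (void B) = exp (- measure \<Lambda> B)"
  unfolding void_eq using prob_num_points[of B 0] by simp

lemma void_Int: "void A \<inter> void B = void (A \<union> B)"
  by (auto simp: void_def)

text \<open>A pi-system whose generated sigma-algebra stands for the information carried by the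
  points in \<open>B\<close>. Finite intensity of \<open>C\<close> is what makes
  \<open>prob_void\<close> applicable.\<close>

definition voids :: "(plane \<times> real) set \<Rightarrow> (plane \<times> real) set set set" where
  "voids B = {void C | C. C \<in> sets \<Lambda> \<and> C \<subseteq> B \<and> emeasure \<Lambda> C < \<infinity>}"

lemma emeasure_Un_finite:
  assumes "A \<in> sets \<Lambda>" "B \<in> sets \<Lambda>" "emeasure \<Lambda> A < \<infinity>" "emeasure \<Lambda> B < \<infinity>"
  shows "emeasure \<Lambda> (A \<union> B) < \<infinity>"
  using emeasure_subadditive[OF assms(1,2)] assms(3,4) by (metis ennreal_add_less_top infinity_ennreal_def le_less_trans)

lemma Int_stable_voids: "Int_stable (voids B)"
proof (rule Int_stableI)
  fix a b assume "a \<in> voids B" "b \<in> voids B"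
  then obtain C D where "a = void C" "C \<in> sets \<Lambda>" "C \<subseteq> B" "emeasure \<Lambda> C < \<infinity>"
     "b = void D" "D \<in> sets \<Lambda>" "D \<subseteq> B" "emeasure \<Lambda> D < \<infinity>"
    unfolding voids_def by blast
  moreover from this have "emeasure \<Lambda> (C \<union> D) < \<infinity>"
    by (intro emeasure_Un_finite)
  ultimately show "a \<inter> b \<in> voids B"
    unfolding voids_def by (auto simp: void_Int intro!: exI[of _ "C \<union> D"])
qed

lemma voids_events: "voids B \<subseteq> events"
  unfolding voids_def using void_event by auto

lemma voids_subset: "voids B \<subseteq> Pow (space P)"
  unfolding voids_def void_def by auto

lemma sigma_voids_events: "sigma_sets (space P) (voids B) \<subseteq> events"
  by (rule sets.sigma_sets_subset[OF voids_events])

lemma sigma_voids_mono: "A \<subseteq> B \<Longrightarrow> sigma_sets (space P) (voids A) \<subseteq> sigma_sets (space P) (voids B)"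
  by (rule sigma_sets_mono') (auto simp: voids_def)

text \<open>The Poisson weights over all natural numbers sum to 1. Membership in
  \<open>configs\<close> gives finiteness on bounded sets only, whereas \<open>touching K\<close> is
  in general unbounded.\<close>

lemma AE_finite:
  assumes "B \<in> sets \<Lambda>" "emeasure \<Lambda> B < \<infinity>"
  shows "AE \<omega> in P. finite (\<omega> \<inter> B)"
proof -
  let ?E = "\<lambda>n. {\<omega> \<in> space P. num_points B \<omega> = of_nat n}"
  let ?m = "measure \<Lambda> B"
  have E: "?E n \<in> events" for n
    using num_points_event[OF assms(1), of "{of_nat n}"] by simp
  have "disjoint_family ?E"
    by (auto simp: disjoint_family_on_def)
  then have "(\<lambda>n. prob (?E n)) sums prob (\<Union>n. ?E n)"
    using E by (intro finite_measure_UNION) auto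
  moreover have "(\<lambda>n. prob (?E n)) sums (exp (- ?m) * exp ?m)"
  proof -
    have "(\<lambda>n. exp (- ?m) * (?m ^ n /\<^sub>R fact n)) sums (exp (- ?m) * exp ?m)"
      by (intro sums_mult exp_converges)
    then show ?thesis
      by (simp add: prob_num_points[OF assms] divide_inverse mult_ac)
  qed
  ultimately have "prob (\<Union>n. ?E n) = exp (- ?m) * exp ?m"
    by (rule sums_unique2)
  also have "\<dots> = 1"
    by (simp add: exp_add[symmetric])
  finally have "AE \<omega> in P. \<omega> \<in> (\<Union>n. ?E n)"
    by (rule AE_prob_1)
  then show ?thesis
    by eventually_elim (auto dest: num_points_of_nat_finite)
qed

section \<open>Events decided by the points in a region\<close>

text \<open>Agreement with \<open>E\<close> is asked for at every configuration with finitely many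
  points in \<open>B\<close>, not merely almost surely, so that it can be evaluated at the image of
  a configuration under an isometry.\<close>

definition determined :: "(plane \<times> real) set \<Rightarrow> ((plane \<times> real) set \<Rightarrow> bool) \<Rightarrow> bool" where
  "determined B \<Psi> \<longleftrightarrow> B \<in> sets \<Lambda> \<and> emeasure \<Lambda> B < \<infinity> \<and>
    (\<exists>E \<in> sigma_sets (space P) (voids B). \<forall>\<omega>\<in>space P. finite (\<omega> \<inter> B) \<longrightarrow> (\<omega> \<in> E \<longleftrightarrow> \<Psi> \<omega>))"

text \<open>\<open>pr \<Psi>\<close> is only meaningful when the event is measurable in the completion:
  \<^const>\<open>measure\<close> is 0 otherwise.\<close>
definition pr :: "((plane \<times> real) set \<Rightarrow> bool) \<Rightarrow> real" where
  "pr \<Psi> = measure (completion P) {\<omega> \<in> space P. \<Psi> \<omega>}"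

lemma determined_not:
  assumes "determined B \<Psi>"
  shows "determined B (\<lambda>\<omega>. \<not> \<Psi> \<omega>)"
proof -
  obtain E where E: "E \<in> sigma_sets (space P) (voids B)" "\<forall>\<omega>\<in>space P. finite (\<omega> \<inter> B) \<longrightarrow> (\<omega> \<in> E \<longleftrightarrow> \<Psi> \<omega>)"
    using assms unfolding determined_def by blast
  have "space P - E \<in> sigma_sets (space P) (voids B)"
    using E(1) by (rule sigma_sets.Compl)
  moreover have "\<forall>\<omega>\<in>space P. finite (\<omega> \<inter> B) \<longrightarrow> (\<omega> \<in> space P - E \<longleftrightarrow> \<not> \<Psi> \<omega>)"
    using E(2) by blast
  ultimately show ?thesis
    using assms unfolding determined_def by blast
qed

lemma determined_cong:
  assumes "determined B \<Psi>" "\<And>\<omega>. \<omega> \<in> space P \<Longrightarrow> \<Psi> \<omega> \<longleftrightarrow> \<Psi>' \<omega>"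
  shows "determined B \<Psi>'"
  using assms unfolding determined_def by auto

text \<open>Almost surely \<open>B\<close> contains finitely many points, so the event differs from
  \<open>E\<close> by a null set, which the completion makes measurable.\<close>

lemma determinedE:
  assumes "determined B \<Psi>"
  obtains E where "E \<in> sigma_sets (space P) (voids B)" "{\<omega> \<in> space P. \<Psi> \<omega>} \<in> sets (completion P)"
    "prob E = pr \<Psi>" "AE \<omega> in P. \<omega> \<in> E \<longleftrightarrow> \<Psi> \<omega>" "\<And>\<omega>. \<omega> \<in> space P \<Longrightarrow> finite (\<omega> \<inter> B) \<Longrightarrow> \<omega> \<in> E \<longleftrightarrow> \<Psi> \<omega>"
proof -
  obtain E where E: "E \<in> sigma_sets (space P) (voids B)" "\<forall>\<omega>\<in>space P. finite (\<omega> \<inter> B) \<longrightarrow> (\<omega> \<in> E \<longleftrightarrow> \<Psi> \<omega>)"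
    using assms unfolding determined_def by blast
  have B: "B \<in> sets \<Lambda>" "emeasure \<Lambda> B < \<infinity>" using assms unfolding determined_def by auto
  have EP: "E \<in> events" using E(1) sigma_voids_events by blast
  have ae: "AE \<omega> in P. \<omega> \<in> E \<longleftrightarrow> \<Psi> \<omega>"
    using AE_finite[OF B] AE_space by eventually_elim (use E(2) in blast)
  have ae': "AE \<omega> in completion P. \<omega> \<in> E \<longleftrightarrow> \<omega> \<in> {\<omega> \<in> space P. \<Psi> \<omega>}"
    using AE_completion[OF ae] AE_space by eventually_elim auto
  have meas: "{\<omega> \<in> space P. \<Psi> \<omega>} \<in> sets (completion P)"
    by (rule completion.in_sets_AE[OF ae']) (use EP in auto)
  have "prob E = measure (completion P) E" using EP by simp
  also have "\<dots> = pr \<Psi>"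
    unfolding pr_def by (rule measure_eq_AE) (use ae' EP meas in auto)
  finally show thesis using that[of E] E meas ae by blast
qed

text \<open>Intensities of disjoint sets add, so void probabilities multiply. Independence passes
  from the two pi-systems to the sigma-algebras that they generate, and then to the
  completion.\<close>

lemma determined_indep:
  assumes "determined A \<Phi>" "determined B \<Psi>" "A \<inter> B = {}"
  shows "pr (\<lambda>\<omega>. \<Phi> \<omega> \<and> \<Psi> \<omega>) = pr \<Phi> * pr \<Psi>"
proof -
  have "indep_set (voids A) (voids B)"
  proof (rule indep_setI)
    fix a b assume "a \<in> voids A" "b \<in> voids B"
    then obtain C D where C: "a = void C" "C \<in> sets \<Lambda>" "C \<subseteq> A" "emeasure \<Lambda> C < \<infinity>"
       and D: "b = void D" "D \<in> sets \<Lambda>" "D \<subseteq> B" "emeasure \<Lambda> D < \<infinity>"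
      unfolding voids_def by blast
    have "C \<inter> D = {}" using C D assms(3) by blast
    then have "measure \<Lambda> (C \<union> D) = measure \<Lambda> C + measure \<Lambda> D"
      using C D by (intro measure_Union) auto
    moreover have "emeasure \<Lambda> (C \<union> D) < \<infinity>"
      using C D by (intro emeasure_Un_finite)
    ultimately show "prob (a \<inter> b) = prob a * prob b"
      unfolding C(1) D(1) void_Int using C D
      by (simp add: prob_void exp_add[symmetric])
  qed (rule voids_events)+
  then have ind: "indep_set (sigma_sets (space P) (voids A)) (sigma_sets (space P) (voids B))"
    by (intro indep_set_sigma_sets Int_stable_voids)
  obtain E where E: "E \<in> sigma_sets (space P) (voids A)" "{\<omega> \<in> space P. \<Phi> \<omega>} \<in> sets (completion P)"
    "prob E = pr \<Phi>" "AE \<omega> in P. \<omega> \<in> E \<longleftrightarrow> \<Phi> \<omega>"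
    by (rule determinedE[OF assms(1)])
  obtain F where F: "F \<in> sigma_sets (space P) (voids B)" "{\<omega> \<in> space P. \<Psi> \<omega>} \<in> sets (completion P)"
    "prob F = pr \<Psi>" "AE \<omega> in P. \<omega> \<in> F \<longleftrightarrow> \<Psi> \<omega>"
    by (rule determinedE[OF assms(2)])
  have EF: "E \<in> events" "F \<in> events" using E(1) F(1) sigma_voids_events by blast+
  have "{\<omega> \<in> space P. \<Phi> \<omega> \<and> \<Psi> \<omega>} = {\<omega> \<in> space P. \<Phi> \<omega>} \<inter> {\<omega> \<in> space P. \<Psi> \<omega>}" by auto
  then have meas: "{\<omega> \<in> space P. \<Phi> \<omega> \<and> \<Psi> \<omega>} \<in> sets (completion P)"
    using E(2) F(2) by simp
  have "AE \<omega> in completion P. \<omega> \<in> {\<omega> \<in> space P. \<Phi> \<omega> \<and> \<Psi> \<omega>} \<longleftrightarrow> \<omega> \<in> E \<inter> F"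
    using AE_completion[OF E(4)] AE_completion[OF F(4)] AE_space by eventually_elim auto
  then have "pr (\<lambda>\<omega>. \<Phi> \<omega> \<and> \<Psi> \<omega>) = measure (completion P) (E \<inter> F)"
    unfolding pr_def by (rule measure_eq_AE) (use meas EF in auto)
  also have "\<dots> = prob (E \<inter> F)" using EF by simp
  also have "\<dots> = prob E * prob F"
    using ind E(1) F(1) by (rule indep_setD)
  finally show ?thesis using E(3) F(3) by simp
qed

text \<open>Up to the null event that \<open>\<omega> \<inter> B\<close> is infinite, \<open>\<Phi> (\<omega> \<inter> B)\<close> is the countable union,
  over the finite unions \<open>U\<close> of basic open sets with \<open>\<Phi> U\<close>, of the events that \<open>\<omega>\<close> has no
  point in \<open>B - U\<close>.\<close>
lemma determined_antimono_open:
  fixes \<Phi> :: "(plane \<times> real) set \<Rightarrow> bool"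
  assumes B: "B \<in> sets \<Lambda>" "emeasure \<Lambda> B < \<infinity>"
    and anti: "\<And>\<omega> \<omega>'. \<omega> \<subseteq> \<omega>' \<Longrightarrow> \<Phi> \<omega>' \<Longrightarrow> \<Phi> \<omega>"
    and op: "\<And>\<omega>. finite \<omega> \<Longrightarrow> \<Phi> \<omega> \<Longrightarrow> \<exists>W. open W \<and> \<omega> \<subseteq> W \<and> \<Phi> W"
  shows "determined B (\<lambda>\<omega>. \<Phi> (\<omega> \<inter> B))"
proof -
  obtain \<B> :: "(plane \<times> real) set set" where \<B>: "countable \<B>" "topological_basis \<B>"
    using ex_countable_basis by blast
  define \<F> where "\<F> = {F. finite F \<and> F \<subseteq> \<B> \<and> \<Phi> (\<Union>F)}"
  have "countable \<F>"
    unfolding \<F>_def by (rule countable_subset[OF _ countable_Collect_finite_subset[OF \<B>(1)]]) auto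
  define E where "E = (\<Union>F\<in>\<F>. void (B - \<Union>F))"
  have "void (B - \<Union>F) \<in> sigma_sets (space P) (voids B)" if "F \<in> \<F>" for F
  proof -
    have "open (\<Union>F)"
      using that topological_basis_open[OF \<B>(2)] unfolding \<F>_def by auto
    then have "\<Union>F \<inter> (UNIV \<times> {0..}) \<in> sets \<Lambda>"
      by (intro borel_in_sets_intensity) simp
    moreover have "B \<subseteq> UNIV \<times> {0..}"
      using sets.sets_into_space[OF B(1)] by (simp add: space_intensity)
    then have "B - \<Union>F = B - \<Union>F \<inter> (UNIV \<times> {0..})" by blast
    ultimately have "B - \<Union>F \<in> sets \<Lambda>" using B(1) by simp
    moreover have "emeasure \<Lambda> (B - \<Union>F) < \<infinity>"
      using emeasure_mono[of "B - \<Union>F" B \<Lambda>] B by (simp add: le_less_trans)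
    ultimately show ?thesis
      by (intro sigma_sets.Basic) (auto simp: voids_def)
  qed
  then have "E \<in> sigma_sets (space P) (voids B)"
    unfolding E_def by (intro sigma_sets_UNION) (use \<open>countable \<F>\<close> in auto)
  moreover have "\<omega> \<in> E \<longleftrightarrow> \<Phi> (\<omega> \<inter> B)" if \<omega>: "\<omega> \<in> space P" "finite (\<omega> \<inter> B)" for \<omega>
  proof
    assume "\<omega> \<in> E"
    then obtain F where "\<Phi> (\<Union>F)" "\<omega> \<inter> B \<subseteq> \<Union>F"
      unfolding E_def \<F>_def void_def by blast
    then show "\<Phi> (\<omega> \<inter> B)" using anti by blast
  next
    assume "\<Phi> (\<omega> \<inter> B)"
    then obtain W where W: "open W" "\<omega> \<inter> B \<subseteq> W" "\<Phi> W" using op \<omega>(2) by blast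
    have "\<exists>V\<in>\<B>. p \<in> V \<and> V \<subseteq> W" if "p \<in> \<omega> \<inter> B" for p
      using topological_basisE[OF \<B>(2) W(1), of p] W(2) that by (metis subsetD)
    then obtain V where V: "\<And>p. p \<in> \<omega> \<inter> B \<Longrightarrow> V p \<in> \<B> \<and> p \<in> V p \<and> V p \<subseteq> W" by metis
    have "\<Union>(V ` (\<omega> \<inter> B)) \<subseteq> W"
      using V by blast
    then have "\<Phi> (\<Union>(V ` (\<omega> \<inter> B)))"
      using W(3) by (rule anti)
    then have "V ` (\<omega> \<inter> B) \<in> \<F>"
      unfolding \<F>_def using \<omega>(2) V by auto
    moreover have "\<omega> \<in> void (B - \<Union>(V ` (\<omega> \<inter> B)))"
      unfolding void_def using \<omega>(1) V by auto
    ultimately show "\<omega> \<in> E" unfolding E_def by blast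
  qed
  ultimately show ?thesis
    unfolding determined_def using B by blast
qed

text \<open>\<open>determined_antimono_open\<close> wants an event that survives the removal of
  discs: vacant crossings qualify, while occupied crossings are reached through their
  complement.\<close>

lemma determined_hcross:
  assumes S: "S \<in> {occupied, vacant}" and "a < b" and B: "B \<in> sets \<Lambda>" "emeasure \<Lambda> B < \<infinity>"
  shows "determined B (\<lambda>\<omega>. hcross (S (\<omega> \<inter> B)) a b c d)"
proof -
  consider "S = occupied" | "S = vacant" using S by blast
  then show ?thesis
  proof cases
    case 1
    have "determined B (\<lambda>\<omega>. \<not> hcross (occupied (\<omega> \<inter> B)) a b c d)"
    proof (rule determined_antimono_open[OF B])
      fix \<omega> \<omega>' :: "(plane \<times> real) set"
      assume "\<omega> \<subseteq> \<omega>'" "\<not> hcross (occupied \<omega>') a b c d"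
      then show "\<not> hcross (occupied \<omega>) a b c d"
        using hcross_mono[of "occupied \<omega>" a b c d "occupied \<omega>'" c d] occupied_mono by blast
    next
      fix \<omega> :: "(plane \<times> real) set"
      assume "finite \<omega>" "\<not> hcross (occupied \<omega>) a b c d"
      then show "\<exists>W. open W \<and> \<omega> \<subseteq> W \<and> \<not> hcross (occupied W) a b c d"
        using \<open>a < b\<close> occupied_noncrossing_open by metis
    qed
    then show ?thesis using determined_not[of B "\<lambda>\<omega>. \<not> hcross (occupied (\<omega> \<inter> B)) a b c d"] 1 by simp
  next
    case 2
    have "determined B (\<lambda>\<omega>. hcross (vacant (\<omega> \<inter> B)) a b c d)"
    proof (rule determined_antimono_open[OF B])
      fix \<omega> \<omega>' :: "(plane \<times> real) set"
      assume "\<omega> \<subseteq> \<omega>'" "hcross (vacant \<omega>') a b c d"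
      then show "hcross (vacant \<omega>) a b c d"
        using hcross_mono[of "vacant \<omega>'" a b c d "vacant \<omega>" c d] occupied_mono[of \<omega> \<omega>']
        unfolding vacant_def by blast
    next
      fix \<omega> :: "(plane \<times> real) set"
      assume "hcross (vacant \<omega>) a b c d"
      then show "\<exists>W. open W \<and> \<omega> \<subseteq> W \<and> hcross (vacant W) a b c d"
        using vacant_crossing_open by metis
    qed
    then show ?thesis using 2 by simp
  qed
qed

lemma restrict_touching:
  assumes S: "S \<in> {occupied, vacant}" and "\<omega> \<in> space P"
  shows "S (\<omega> \<inter> touching K) \<inter> K = S \<omega> \<inter> K"
proof -
  have "0 \<le> z" if "(x, z) \<in> \<omega>" for x z
    using assms(2) that unfolding space_P configs_def by auto
  then have "occupied (\<omega> \<inter> touching K) \<inter> K = occupied \<omega> \<inter> K"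
    unfolding occupied_def touching_def by fastforce
  then show ?thesis using S unfolding vacant_def by blast
qed

lemma determined_hcross_touching:
  assumes S: "S \<in> {occupied, vacant}" and "a < b"
  shows "determined (touching ({a..b} \<times> {c..d})) (\<lambda>\<omega>. hcross (S \<omega>) a b c d)"
proof (rule determined_cong)
  have "compact ({a..b} \<times> {c..d})" by (intro compact_Times compact_Icc)
  then show "determined (touching ({a..b} \<times> {c..d})) (\<lambda>\<omega>. hcross (S (\<omega> \<inter> touching ({a..b} \<times> {c..d}))) a b c d)"
    by (intro determined_hcross assms touching_in_sets touching_finite lam_nonneg)
  fix \<omega> assume "\<omega> \<in> space P"
  then show "hcross (S (\<omega> \<inter> touching ({a..b} \<times> {c..d}))) a b c d \<longleftrightarrow> hcross (S \<omega>) a b c d"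
    by (intro hcross_cong restrict_touching S)
qed

section \<open>Invariance under isometries of the plane\<close>

definition lift :: "(plane \<Rightarrow> plane) \<Rightarrow> plane \<times> real \<Rightarrow> plane \<times> real" where
  "lift T p = (T (fst p), snd p)"

context
  fixes T :: "plane \<Rightarrow> plane"
  assumes isom: "\<And>x y. dist (T x) (T y) = dist x y" and surj: "surj T"
    and lebesgue: "distr lborel borel T = lborel"
begin

lemma T_inj: "inj T"
proof (rule injI)
  fix x y assume "T x = T y"
  then show "x = y" using isom[of x y] by simp
qed

lemma T_measurable: "T \<in> borel_measurable borel"
proof (rule borel_measurable_continuous_onI)
  show "continuous_on UNIV T"
    by (auto simp: continuous_on_iff isom)
qed

text \<open>At each fixed radius the slice of the preimage is the preimage under \<open>T\<close> of
  the slice, and \<open>T\<close> preserves Lebesgue measure.\<close>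

lemma lift_vimage:
  assumes "B \<in> sets \<Lambda>"
  shows "lift T -` B \<inter> (UNIV \<times> {0..}) \<in> sets \<Lambda>"
    and "emeasure \<Lambda> (lift T -` B \<inter> (UNIV \<times> {0..})) = emeasure \<Lambda> B"
proof -
  have "lift T \<in> measurable (lborel \<Otimes>\<^sub>M mu) (lborel \<Otimes>\<^sub>M mu)"
    unfolding lift_def[abs_def]
  proof (rule measurable_Pair)
    show "(\<lambda>p. T (fst p)) \<in> (lborel \<Otimes>\<^sub>M mu) \<rightarrow>\<^sub>M lborel"
      using measurable_compose[OF measurable_fst[of lborel mu], of T borel] T_measurable by simp
  qed simp
  from measurable_sets[OF this] assms
  show *: "lift T -` B \<inter> (UNIV \<times> {0..}) \<in> sets \<Lambda>"
    unfolding sets_intensity by (simp add: space_pair_measure space_mu)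
  have "emeasure lborel ((\<lambda>x. (x, z)) -` (lift T -` B \<inter> (UNIV \<times> {0..}))) = emeasure lborel ((\<lambda>x. (x, z)) -` B)"
    if "z \<in> space mu" for z
  proof -
    have slice: "(\<lambda>x. (x, z)) -` B \<in> sets borel"
      using sets_Pair2[of B lborel mu z] assms by (simp add: sets_intensity)
    have "emeasure lborel ((\<lambda>x. (x, z)) -` B) = emeasure (distr lborel borel T) ((\<lambda>x. (x, z)) -` B)"
      by (simp add: lebesgue)
    also have "\<dots> = emeasure lborel (T -` (\<lambda>x. (x, z)) -` B)"
      using slice T_measurable by (subst emeasure_distr) auto
    also have "T -` (\<lambda>x. (x, z)) -` B = (\<lambda>x. (x, z)) -` (lift T -` B \<inter> (UNIV \<times> {0..}))"
      using that by (auto simp: lift_def space_mu)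
    finally show ?thesis by simp
  qed
  then show "emeasure \<Lambda> (lift T -` B \<inter> (UNIV \<times> {0..})) = emeasure \<Lambda> B"
    unfolding emeasure_intensity[OF *] emeasure_intensity[OF assms]
    by (intro arg_cong2[where f = "(*)"] nn_integral_cong refl)
qed

text \<open>Since \<open>lift T\<close> is again an isometry, preimages of bounded sets are bounded,
  which carries local finiteness over to the image.\<close>

lemma lift_config:
  assumes "\<omega> \<in> space P"
  shows "lift T ` \<omega> \<in> space P"
  unfolding space_P configs_def
proof (intro CollectI conjI allI impI)
  show "lift T ` \<omega> \<subseteq> UNIV \<times> {0..}"
    using assms unfolding space_P configs_def lift_def by auto
  fix B :: "(plane \<times> real) set" assume "bounded B"
  obtain p :: "plane \<times> real" where True by blast
  have d: "dist (lift T p) (lift T q) = dist p q" for p q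
    by (simp only: lift_def dist_Pair_Pair isom) (simp only: dist_prod_def)
  obtain e where "\<forall>y\<in>B. dist (lift T p) y \<le> e"
    using \<open>bounded B\<close> bounded_any_center by blast
  then have "\<forall>q\<in>lift T -` B. dist p q \<le> e" by (metis d vimageD)
  then have "bounded (lift T -` B)" unfolding bounded_def by blast
  then have "finite (\<omega> \<inter> lift T -` B)"
    using assms unfolding space_P configs_def by blast
  then have "finite (lift T ` (\<omega> \<inter> lift T -` B))" by simp
  moreover have "lift T ` \<omega> \<inter> B = lift T ` (\<omega> \<inter> lift T -` B)" by blast
  ultimately show "finite (lift T ` \<omega> \<inter> B)" by simp
qed

lemma lift_void:
  "{\<omega> \<in> space P. lift T ` \<omega> \<in> void B} = void (lift T -` B \<inter> (UNIV \<times> {0..}))"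
proof -
  have "lift T ` \<omega> \<inter> B = {} \<longleftrightarrow> \<omega> \<inter> (lift T -` B \<inter> (UNIV \<times> {0..})) = {}" if "\<omega> \<in> space P" for \<omega>
    using that unfolding space_P configs_def by blast
  then show ?thesis
    unfolding void_def using lift_config by blast
qed

text \<open>The lifted and the original configuration give each void event the same probability,
  because the preimage of a region has the same intensity. Void events form a pi-system, so the two
  laws agree on the sigma-algebra generated.\<close>

lemma prob_lift:
  assumes "E \<in> sigma_sets (space P) (voids UNIV)"
  shows "{\<omega> \<in> space P. lift T ` \<omega> \<in> E} \<in> events" "prob {\<omega> \<in> space P. lift T ` \<omega> \<in> E} = prob E"
proof -
  let ?N = "sigma (space P) (voids UNIV)"
  have N: "sets ?N = sigma_sets (space P) (voids UNIV)" "space ?N = space P"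
    using voids_subset by (simp_all add: space_measure_of sets_measure_of)
  have voidsE: "\<exists>B. X = void B \<and> B \<in> sets \<Lambda> \<and> emeasure \<Lambda> B < \<infinity>" if "X \<in> voids UNIV" for X
    using that unfolding voids_def by blast
  have m: "(\<lambda>\<omega>. lift T ` \<omega>) \<in> measurable P ?N"
  proof (rule measurable_measure_of[OF voids_subset])
    fix X assume "X \<in> voids UNIV"
    then obtain B where "X = void B" "B \<in> sets \<Lambda>" using voidsE by blast
    then have "{\<omega> \<in> space P. lift T ` \<omega> \<in> X} \<in> events"
      using lift_void void_event lift_vimage(1) by simp
    then show "(`) (lift T) -` X \<inter> space P \<in> events"
      by (rule back_subst[of "\<lambda>A. A \<in> events"]) auto
  qed (use lift_config in auto)
  have i: "(\<lambda>\<omega>. \<omega>) \<in> measurable P ?N"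
    by (rule measurable_measure_of[OF voids_subset]) (use voids_events in \<open>auto intro!: sets.Int\<close>)
  have "distr P ?N (\<lambda>\<omega>. lift T ` \<omega>) = distr P ?N (\<lambda>\<omega>. \<omega>)"
  proof (rule measure_eqI_generator_eq[OF Int_stable_voids voids_subset, where A = "\<lambda>_. space P"])
    fix X assume X: "X \<in> voids UNIV"
    then obtain B where B: "X = void B" "B \<in> sets \<Lambda>" "emeasure \<Lambda> B < \<infinity>" using voidsE by blast
    have XN: "X \<in> sets ?N" using X N by (auto intro: sigma_sets.Basic)
    have "emeasure (distr P ?N (\<lambda>\<omega>. lift T ` \<omega>)) X = emeasure P ((\<lambda>\<omega>. lift T ` \<omega>) -` X \<inter> space P)"
      by (rule emeasure_distr[OF m XN])
    also have "\<dots> = emeasure P {\<omega> \<in> space P. lift T ` \<omega> \<in> void B}"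
      unfolding B(1) by (rule arg_cong[where f = "emeasure P"]) auto
    also have "\<dots> = ennreal (exp (- measure \<Lambda> (lift T -` B \<inter> (UNIV \<times> {0..}))))"
      unfolding lift_void emeasure_eq_measure using B lift_vimage[OF B(2)] by (subst prob_void) auto
    also have "\<dots> = ennreal (prob (void B))"
      using lift_vimage(2)[OF B(2)] prob_void[OF B(2,3)] by (simp add: measure_def[of \<Lambda>])
    also have "\<dots> = emeasure P ((\<lambda>\<omega>. \<omega>) -` X \<inter> space P)"
      unfolding emeasure_eq_measure B(1) by (rule arg_cong[where f = "\<lambda>A. ennreal (prob A)"]) (auto simp: void_def)
    also have "\<dots> = emeasure (distr P ?N (\<lambda>\<omega>. \<omega>)) X"
      by (rule emeasure_distr[OF i XN, symmetric])
    finally show "emeasure (distr P ?N (\<lambda>\<omega>. lift T ` \<omega>)) X = emeasure (distr P ?N (\<lambda>\<omega>. \<omega>)) X" .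
  next
    \<comment> \<open>The uniqueness theorem needs the space to be exhausted by generators; the void
      event of the empty set is already everything.\<close>
    have "space P = void {}" by (simp add: void_def)
    then show "range (\<lambda>_. space P) \<subseteq> voids UNIV"
      by (auto simp: voids_def intro!: exI[of _ "{}"])
    have "space P \<in> sets ?N"
      using sets.top[of ?N] unfolding N(2) .
    then show "emeasure (distr P ?N (\<lambda>\<omega>. lift T ` \<omega>)) (space P) \<noteq> \<infinity>"
      by (simp add: emeasure_distr[OF m] emeasure_eq_measure)
  qed (use N in simp_all)
  then have eq: "emeasure P ((\<lambda>\<omega>. lift T ` \<omega>) -` E \<inter> space P) = emeasure P ((\<lambda>\<omega>. \<omega>) -` E \<inter> space P)"
    using emeasure_distr[OF m, of E] emeasure_distr[OF i, of E] assms N by simp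
  have v: "(\<lambda>\<omega>. lift T ` \<omega>) -` E \<inter> space P = {\<omega> \<in> space P. lift T ` \<omega> \<in> E}"
    by auto
  have w: "(\<lambda>\<omega>. \<omega>) -` E \<inter> space P = E"
    using sigma_sets_into_sp[OF voids_subset assms] by auto
  show "{\<omega> \<in> space P. lift T ` \<omega> \<in> E} \<in> events"
    using measurable_sets[OF m, of E] assms N unfolding v by simp
  show "prob {\<omega> \<in> space P. lift T ` \<omega> \<in> E} = prob E"
    using eq unfolding v w by (simp add: measure_def)
qed

lemma occupied_lift: "occupied (lift T ` \<omega>) = T ` occupied \<omega>"
proof -
  have *: "cball (T x) z = T ` cball x z" for x z
  proof
    show "cball (T x) z \<subseteq> T ` cball x z"
    proof
      fix y assume "y \<in> cball (T x) z"
      obtain y' where "y = T y'" using surj by blast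
      with \<open>y \<in> cball (T x) z\<close> show "y \<in> T ` cball x z" by (auto simp: isom)
    qed
  qed (auto simp: isom)
  show ?thesis unfolding occupied_def lift_def by (simp add: * case_prod_unfold image_UN)
qed

lemma vacant_lift: "vacant (lift T ` \<omega>) = T ` vacant \<omega>"
  unfolding vacant_def occupied_lift using bij_image_Compl_eq[of T] T_inj surj by (simp add: bij_def)

lemma pr_hcross_image:
  assumes S: "S \<in> {occupied, vacant}" and "a < b"
  shows "{\<omega> \<in> space P. hcross (T ` S \<omega>) a b c d} \<in> sets (completion P)"
    and "pr (\<lambda>\<omega>. hcross (T ` S \<omega>) a b c d) = pr (\<lambda>\<omega>. hcross (S \<omega>) a b c d)"
proof -
  let ?B = "touching ({a..b} \<times> {c..d})"
  have det: "determined ?B (\<lambda>\<omega>. hcross (S \<omega>) a b c d)"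
    using assms by (rule determined_hcross_touching)
  then have B: "?B \<in> sets \<Lambda>" "emeasure \<Lambda> ?B < \<infinity>" unfolding determined_def by auto
  obtain E where E: "E \<in> sigma_sets (space P) (voids ?B)"
    "{\<omega> \<in> space P. hcross (S \<omega>) a b c d} \<in> sets (completion P)"
    "prob E = pr (\<lambda>\<omega>. hcross (S \<omega>) a b c d)"
    "AE \<omega> in P. \<omega> \<in> E \<longleftrightarrow> hcross (S \<omega>) a b c d"
    "\<And>\<omega>. \<omega> \<in> space P \<Longrightarrow> finite (\<omega> \<inter> ?B) \<Longrightarrow> \<omega> \<in> E \<longleftrightarrow> hcross (S \<omega>) a b c d"
    by (rule determinedE[OF det]) blast
  have E': "E \<in> sigma_sets (space P) (voids UNIV)" using E(1) sigma_voids_mono by blast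
  let ?E = "{\<omega> \<in> space P. lift T ` \<omega> \<in> E}"
  \<comment> \<open>\<open>E\<close> decides the crossing at the lifted configuration once that has
    finitely many points in \<open>?B\<close>, which holds if \<open>\<omega>\<close> has finitely
    many in the preimage of \<open>?B\<close>.\<close>
  have "AE \<omega> in P. finite (\<omega> \<inter> (lift T -` ?B \<inter> (UNIV \<times> {0..})))"
    by (rule AE_finite) (use lift_vimage[OF B(1)] B in auto)
  then have "AE \<omega> in P. \<omega> \<in> ?E \<longleftrightarrow> \<omega> \<in> {\<omega> \<in> space P. hcross (T ` S \<omega>) a b c d}"
    using AE_space
  proof eventually_elim
    case (elim \<omega>)
    have "lift T ` \<omega> \<inter> ?B \<subseteq> lift T ` (\<omega> \<inter> (lift T -` ?B \<inter> (UNIV \<times> {0..})))"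
      using elim(2) unfolding space_P configs_def by blast
    then have "finite (lift T ` \<omega> \<inter> ?B)" using elim(1) finite_subset by blast
    then have "lift T ` \<omega> \<in> E \<longleftrightarrow> hcross (S (lift T ` \<omega>)) a b c d"
      using E(5) lift_config elim(2) by blast
    also have "S (lift T ` \<omega>) = T ` S \<omega>" using S occupied_lift vacant_lift by auto
    finally show ?case using elim(2) by simp
  qed
  then have ae: "AE \<omega> in completion P. \<omega> \<in> ?E \<longleftrightarrow> \<omega> \<in> {\<omega> \<in> space P. hcross (T ` S \<omega>) a b c d}"
    by (rule AE_completion)
  show meas: "{\<omega> \<in> space P. hcross (T ` S \<omega>) a b c d} \<in> sets (completion P)"
    by (rule completion.in_sets_AE[OF ae]) (use prob_lift(1)[OF E'] in auto)
  have "measure (completion P) ?E = pr (\<lambda>\<omega>. hcross (T ` S \<omega>) a b c d)"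
    unfolding pr_def by (intro measure_eq_AE[OF ae] meas) (use prob_lift(1)[OF E'] in auto)
  then show "pr (\<lambda>\<omega>. hcross (T ` S \<omega>) a b c d) = pr (\<lambda>\<omega>. hcross (S \<omega>) a b c d)"
    using prob_lift[OF E'] E(3) by simp
qed

end

end

section \<open>Renormalization\<close>

text \<open>Once \<open>b\<close> is below \<open>\<epsilon> / 4\<close>, compare with the map from
  \<open>x\<close> to \<open>x / 2 + \<epsilon> / 4\<close>: its fixed point is
  \<open>\<epsilon> / 2\<close>, and the excess over it is halved at each step.\<close>

lemma tendsto_0_perturbed_halving:
  fixes a b :: "nat \<Rightarrow> real"
  assumes nonneg: "\<And>k. 0 \<le> a k" and step: "\<And>k. a (Suc k) \<le> a k / 2 + b k" and b: "b \<longlonglongrightarrow> 0"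
  shows "a \<longlonglongrightarrow> 0"
proof (rule LIMSEQ_I)
  fix \<epsilon> :: real assume "0 < \<epsilon>"
  then obtain N where N: "\<And>k. N \<le> k \<Longrightarrow> norm (b k - 0) < \<epsilon> / 4"
    using LIMSEQ_D[OF b, of "\<epsilon> / 4"] by auto
  have decay: "a (N + m) \<le> a N * (1 / 2) ^ m + \<epsilon> / 2" for m
  proof (induction m)
    case 0
    then show ?case using \<open>0 < \<epsilon>\<close> by simp
  next
    case (Suc m)
    have "b (N + m) < \<epsilon> / 4" using N[of "N + m"] by simp
    then show ?case using step[of "N + m"] Suc by simp
  qed
  have "(\<lambda>m. a N * (1 / 2) ^ m) \<longlonglongrightarrow> a N * 0"
    by (intro tendsto_mult LIMSEQ_power_zero) auto
  then obtain M where M: "\<And>m. M \<le> m \<Longrightarrow> norm (a N * (1 / 2) ^ m - 0) < \<epsilon> / 2"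
    using LIMSEQ_D[of _ "0::real" "\<epsilon> / 2"] \<open>0 < \<epsilon>\<close> by fastforce
  have "norm (a n - 0) < \<epsilon>" if "N + M \<le> n" for n
  proof -
    have "a n \<le> a N * (1 / 2) ^ (n - N) + \<epsilon> / 2" using decay[of "n - N"] that by simp
    moreover have "norm (a N * (1 / 2) ^ (n - N) - 0) < \<epsilon> / 2" using that by (intro M) simp
    ultimately show ?thesis using nonneg[of n] nonneg[of N] by simp
  qed
  then show "\<exists>no. \<forall>n\<ge>no. norm (a n - 0) < \<epsilon>" by blast
qed

text \<open>Summing the recurrence bounds a partial sum \<open>A\<close> by
  \<open>a 0 + A / 2 + suminf b\<close>; solve for \<open>A\<close>.\<close>

lemma summable_perturbed_halving:
  fixes a b :: "nat \<Rightarrow> real"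
  assumes nonneg: "\<And>k. 0 \<le> a k" "\<And>k. 0 \<le> b k" and step: "\<And>k. a (Suc k) \<le> a k / 2 + b k" and b: "summable b"
  shows "summable a"
proof (rule bounded_imp_summable)
  fix n
  have "(\<Sum>k\<le>n. a k) = a 0 + (\<Sum>k<n. a (Suc k))"
    by (induction n) auto
  moreover have "(\<Sum>k<n. a (Suc k)) \<le> (\<Sum>k<n. a k / 2 + b k)"
    by (intro sum_mono step)
  moreover have "(\<Sum>k<n. a k / 2 + b k) = (\<Sum>k<n. a k) / 2 + (\<Sum>k<n. b k)"
    by (simp add: sum.distrib sum_divide_distrib)
  moreover have "(\<Sum>k<n. b k) \<le> suminf b"
    using b nonneg by (intro sum_le_suminf) auto
  moreover have "(\<Sum>k<n. a k) \<le> (\<Sum>k\<le>n. a k)"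
    using nonneg by (intro sum_mono2) auto
  ultimately show "(\<Sum>k\<le>n. a k) \<le> 2 * (a 0 + suminf b)" by argo
qed (rule nonneg)

lemma filterlim_geometric: "0 < r \<Longrightarrow> filterlim (\<lambda>k. 3 ^ k * r) at_top sequentially" for r :: real
  by (rule filterlim_at_top_mult_tendsto_pos[OF tendsto_const _ filterlim_at_infinity_imp_filterlim_at_top])
    (auto intro: filterlim_realpow_sequentially_gt1)

lemma lborel_distr_swap: "distr lborel borel prod.swap = (lborel :: plane measure)"
proof -
  have "(lborel :: plane measure) = distr (lborel \<Otimes>\<^sub>M lborel) (lborel \<Otimes>\<^sub>M lborel) (\<lambda>(x, y). (y, x))"
    using lborel_pair.distr_pair_swap unfolding lborel_prod .
  also have "\<dots> = distr lborel borel prod.swap"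
    unfolding lborel_prod by (intro distr_cong) (auto simp: prod.swap_def)
  finally show ?thesis by simp
qed

section \<open>Failure probabilities of crossings\<close>

context boolean_model
begin

sublocale compl: prob_space "completion P"
  by (rule prob_space_completion)

abbreviation ev :: "((plane \<times> real) set \<Rightarrow> bool) \<Rightarrow> bool" where
  "ev \<Psi> \<equiv> {\<omega> \<in> space P. \<Psi> \<omega>} \<in> sets (completion P)"

lemma ev_not: "ev \<Psi> \<Longrightarrow> ev (\<lambda>\<omega>. \<not> \<Psi> \<omega>)"
  using sets.sets_Collect_neg[of "completion P" \<Psi>] by simp

lemma ev_conj: "ev \<Psi> \<Longrightarrow> ev \<Phi> \<Longrightarrow> ev (\<lambda>\<omega>. \<Psi> \<omega> \<and> \<Phi> \<omega>)"
  using sets.sets_Collect_conj[of "completion P" \<Phi> \<Psi>] by simp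

lemma pr_not: "ev \<Psi> \<Longrightarrow> pr (\<lambda>\<omega>. \<not> \<Psi> \<omega>) = 1 - pr \<Psi>"
  unfolding pr_def using compl.prob_neg[of \<Psi>] by simp

lemma pr_mono:
  assumes "\<And>\<omega>. \<omega> \<in> space P \<Longrightarrow> \<Psi> \<omega> \<Longrightarrow> \<Phi> \<omega>" "ev \<Phi>"
  shows "pr \<Psi> \<le> pr \<Phi>"
  unfolding pr_def by (rule compl.finite_measure_mono) (use assms in auto)

lemma pr_le_add:
  assumes "\<And>\<omega>. \<omega> \<in> space P \<Longrightarrow> \<Psi> \<omega> \<Longrightarrow> \<Phi> \<omega> \<or> \<Phi>' \<omega>" "ev \<Phi>" "ev \<Phi>'"
  shows "pr \<Psi> \<le> pr \<Phi> + pr \<Phi>'"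
proof -
  have "pr \<Psi> \<le> measure (completion P) ({\<omega> \<in> space P. \<Phi> \<omega>} \<union> {\<omega> \<in> space P. \<Phi>' \<omega>})"
    unfolding pr_def by (rule compl.finite_measure_mono) (use assms in auto)
  also have "\<dots> \<le> pr \<Phi> + pr \<Phi>'"
    unfolding pr_def by (rule measure_Un_le) (use assms in auto)
  finally show ?thesis .
qed

lemma pr_Bex_le:
  assumes "finite I" "\<And>i. i \<in> I \<Longrightarrow> ev (\<Psi> i)"
  shows "ev (\<lambda>\<omega>. \<exists>i\<in>I. \<Psi> i \<omega>)" "pr (\<lambda>\<omega>. \<exists>i\<in>I. \<Psi> i \<omega>) \<le> (\<Sum>i\<in>I. pr (\<Psi> i))"
proof -
  have eq: "{\<omega> \<in> space P. \<exists>i\<in>I. \<Psi> i \<omega>} = (\<Union>i\<in>I. {\<omega> \<in> space P. \<Psi> i \<omega>})" by auto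
  show "ev (\<lambda>\<omega>. \<exists>i\<in>I. \<Psi> i \<omega>)"
    unfolding eq using assms by (intro sets.finite_UN) auto
  show "pr (\<lambda>\<omega>. \<exists>i\<in>I. \<Psi> i \<omega>) \<le> (\<Sum>i\<in>I. pr (\<Psi> i))"
    unfolding pr_def eq using assms by (intro compl.finite_measure_subadditive_finite) auto
qed

lemma ev_determined: "determined B \<Psi> \<Longrightarrow> ev \<Psi>"
  by (erule determinedE)

text \<open>The map \<open>S\<close> from configurations to plane sets is a parameter, so that one
  argument serves both \<open>occupied\<close> and \<open>vacant\<close>.\<close>

definition fail :: "((plane \<times> real) set \<Rightarrow> plane set) \<Rightarrow> real \<Rightarrow> real" where
  "fail S r = 1 - pr (\<lambda>\<omega>. hcross (S \<omega>) 0 (3 * r) 0 r)"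

lemma fail_nonneg: "0 \<le> fail S r"
  unfolding fail_def pr_def using compl.prob_le_1 by simp

context
  fixes S :: "(plane \<times> real) set \<Rightarrow> plane set"
  assumes S: "S \<in> {occupied, vacant}"
begin

lemma ev_hcross: "a < b \<Longrightarrow> ev (\<lambda>\<omega>. hcross (S \<omega>) a b c d)"
  by (rule ev_determined[OF determined_hcross_touching[OF S]])

lemma pr_hcross_translate:
  assumes "a < b"
  shows "pr (\<lambda>\<omega>. hcross (S \<omega>) (u + a) (u + b) (v + c) (v + d)) = pr (\<lambda>\<omega>. hcross (S \<omega>) a b c d)"
proof -
  have "hcross (S \<omega>) (u + a) (u + b) (v + c) (v + d) \<longleftrightarrow> hcross ((+) (- u, - v) ` S \<omega>) a b c d" for \<omega>
    using hcross_translate[of "- u" "- v" "S \<omega>" "u + a" "u + b" "v + c" "v + d"] by simp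
  then show ?thesis
    using pr_hcross_image(2)[OF _ surj_plus lborel_distr_plus S assms, of "(- u, - v)" c d] by simp
qed

text \<open>Swapping coordinates is an isometry that preserves Lebesgue measure.\<close>

lemma vcross_event:
  assumes "c < d"
  shows "ev (\<lambda>\<omega>. vcross (S \<omega>) a b c d)" "pr (\<lambda>\<omega>. vcross (S \<omega>) a b c d) = pr (\<lambda>\<omega>. hcross (S \<omega>) c d a b)"
  unfolding vcross_def
  by (rule pr_hcross_image[OF _ surj_swap lborel_distr_swap S assms], simp add: dist_prod_def add.commute)+

lemma pr_not_hcross:
  assumes "0 < r"
  shows "pr (\<lambda>\<omega>. \<not> hcross (S \<omega>) u (u + 3 * r) v (v + r)) = fail S r"
  using pr_not[OF ev_hcross, of u "u + 3 * r" v "v + r"] pr_hcross_translate[of 0 "3 * r" u v 0 r] assms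
  by (simp add: fail_def)

lemma pr_not_vcross:
  assumes "0 < r"
  shows "pr (\<lambda>\<omega>. \<not> vcross (S \<omega>) u (u + r) v (v + 3 * r)) = fail S r"
  using pr_not[OF vcross_event(1), of v "v + 3 * r" u "u + r"] vcross_event(2)[of v "v + 3 * r" u "u + r"]
    pr_hcross_translate[of 0 "3 * r" v u 0 r] assms
  by (simp add: fail_def)

text \<open>A union bound over four horizontal and three vertical crossings, each failing with
  probability \<open>fail S r\<close>. The offset \<open>c\<close> places the vertical ones in a
  band of height 3r that contains the strip.\<close>

lemma pr_strip_fail:
  assumes r: "0 < r" and c: "c \<le> c1" "c1 + r \<le> c + 3 * r"
  shows "pr (\<lambda>\<omega>. \<not> hcross (S \<omega>) 0 (9 * r) c1 (c1 + r)) \<le> 7 * fail S r"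
proof -
  let ?h = "\<lambda>i \<omega>. \<not> hcross (S \<omega>) (2 * r * real i) (2 * r * real i + 3 * r) c1 (c1 + r)"
  let ?v = "\<lambda>i \<omega>. \<not> vcross (S \<omega>) (2 * r * real (Suc i)) (2 * r * real (Suc i) + r) c (c + 3 * r)"
  have evh: "ev (?h i)" and evv: "ev (?v i)" for i
    using r by (intro ev_not ev_hcross vcross_event(1); simp)+
  have "pr (\<lambda>\<omega>. \<not> hcross (S \<omega>) 0 (9 * r) c1 (c1 + r))
      \<le> pr (\<lambda>\<omega>. \<exists>i\<in>{..<4}. ?h i \<omega>) + pr (\<lambda>\<omega>. \<exists>i\<in>{..<3}. ?v i \<omega>)"
  proof (rule pr_le_add)
    fix \<omega> assume "\<not> hcross (S \<omega>) 0 (9 * r) c1 (c1 + r)"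
    then show "(\<exists>i\<in>{..<4}. ?h i \<omega>) \<or> (\<exists>i\<in>{..<3}. ?v i \<omega>)"
      using hcross_strip[OF r c] by (metis lessThan_iff)
  qed (intro pr_Bex_le finite_lessThan evh evv)+
  also have "\<dots> \<le> (\<Sum>i<4. pr (?h i)) + (\<Sum>i<3. pr (?v i))"
    by (intro add_mono pr_Bex_le finite_lessThan evh evv)
  also have "\<dots> = 7 * fail S r"
    by (simp only: pr_not_hcross[OF r] pr_not_vcross[OF r]) simp
  finally show ?thesis .
qed

text \<open>The 9r x r strip is at least as long as the 3s x s rectangle and no taller, so a
  crossing of the strip can be shortened to one of the rectangle. This fills in the scales between
  consecutive powers of 3.\<close>

lemma fail_interpolate:
  assumes "0 < r" "r \<le> s" "s \<le> 3 * r"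
  shows "fail S s \<le> 7 * fail S r"
proof -
  have "fail S s = pr (\<lambda>\<omega>. \<not> hcross (S \<omega>) 0 (3 * s) 0 s)"
    unfolding fail_def using assms by (subst pr_not) (auto intro!: ev_hcross)
  also have "\<dots> \<le> pr (\<lambda>\<omega>. \<not> hcross (S \<omega>) 0 (9 * r) 0 (0 + r))"
  proof (rule pr_mono)
    fix \<omega> assume no: "\<not> hcross (S \<omega>) 0 (3 * s) 0 s"
    show "\<not> hcross (S \<omega>) 0 (9 * r) 0 (0 + r)"
    proof
      assume "hcross (S \<omega>) 0 (9 * r) 0 (0 + r)"
      then have "hcross (S \<omega>) 0 (3 * s) 0 (0 + r)"
        by (rule hcross_subrectangle) (use assms in auto)
      then have "hcross (S \<omega>) 0 (3 * s) 0 s"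
        by (rule hcross_mono) (use assms in auto)
      with no show False by simp
    qed
  qed (use assms in \<open>auto intro!: ev_not ev_hcross\<close>)
  also have "\<dots> \<le> 7 * fail S r"
    by (rule pr_strip_fail[where c = 0]) (use assms in auto)
  finally show ?thesis .
qed

lemma fail_renormalize:
  assumes r: "0 < r"
  shows "fail S (3 * r) \<le> (7 * fail S r + lam * tail r)\<^sup>2 + lam * tail r"
proof -
  let ?e = "lam * tail r"
  \<comment> \<open>The upper ends are written as sums to match the form \<open>c1 + r\<close> in
    \<open>pr_strip_fail\<close>.\<close>
  let ?K = "{0..9 * r} \<times> {0..0 + r}" and ?L = "{0..9 * r} \<times> {2 * r..2 * r + r}"
  let ?A = "touching ?K" and ?B = "touching ?L"
  let ?N = "\<lambda>\<omega> :: (plane \<times> real) set. \<omega> \<inter> (?A \<inter> ?B) \<noteq> {}"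
  let ?a = "\<lambda>\<omega>. hcross (S \<omega>) 0 (9 * r) 0 (0 + r)" and ?b = "\<lambda>\<omega>. hcross (S \<omega>) 0 (9 * r) (2 * r) (2 * r + r)"
  \<comment> \<open>These versions look only at discs touching exactly one of the strips, so they
    depend on disjoint regions.\<close>
  let ?a' = "\<lambda>\<omega>. ?a (\<omega> \<inter> (?A - ?B))" and ?b' = "\<lambda>\<omega>. ?b (\<omega> \<inter> (?B - ?A))"
  have sets: "?A \<in> sets \<Lambda>" "?B \<in> sets \<Lambda>"
    by (intro touching_in_sets compact_Times compact_Icc)+
  have fin: "emeasure \<Lambda> ?A < \<infinity>" "emeasure \<Lambda> ?B < \<infinity>"
    by (intro touching_finite compact_Times compact_Icc lam_nonneg)+
  have e0: "0 \<le> ?e" using lam_nonneg tail_nonneg by simp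
  have "emeasure \<Lambda> (?A \<inter> ?B) \<le> ennreal ?e"
    using touching_both_strips_le[OF r lam_nonneg] by simp
  then have AB: "emeasure \<Lambda> (?A \<inter> ?B) < \<infinity>" "measure \<Lambda> (?A \<inter> ?B) \<le> ?e"
    using e0 by (auto simp: measure_def enn2real_leI intro: le_less_trans)
  have void: "{\<omega> \<in> space P. \<omega> \<inter> (?A \<inter> ?B) = {}} = void (?A \<inter> ?B)" by (simp add: void_def)
  have ev_void: "void (?A \<inter> ?B) \<in> events" using void_event sets by blast
  then have evN': "ev (\<lambda>\<omega>. \<omega> \<inter> (?A \<inter> ?B) = {})" unfolding void by simp
  then have evN: "ev ?N" by (rule ev_not)
  have "pr ?N = 1 - pr (\<lambda>\<omega>. \<omega> \<inter> (?A \<inter> ?B) = {})" using evN' by (rule pr_not)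
  also have "\<dots> = 1 - exp (- measure \<Lambda> (?A \<inter> ?B))"
    unfolding pr_def void using ev_void AB sets by (simp add: prob_void)
  \<comment> \<open>\<open>1 - exp (- m)\<close> is at most \<open>m\<close>: some point is present
    with probability at most the expected number of points.\<close>
  also have "\<dots> \<le> ?e"
    using exp_ge_add_one_self[of "- measure \<Lambda> (?A \<inter> ?B)"] AB(2) by simp
  finally have N: "pr ?N \<le> ?e" .
  have diff_le: "emeasure \<Lambda> (?A - ?B) < \<infinity>" "emeasure \<Lambda> (?B - ?A) < \<infinity>"
    using fin sets by (auto intro: le_less_trans[OF emeasure_mono])
  have "0 < 9 * r" using r by simp
  then have deta: "determined (?A - ?B) ?a'" and detb: "determined (?B - ?A) ?b'"
    using determined_hcross[OF S _ sets.Diff[OF sets(1,2)] diff_le(1)]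
      determined_hcross[OF S _ sets.Diff[OF sets(2,1)] diff_le(2)] by blast+
  note eva = ev_determined[OF deta] and evb = ev_determined[OF detb]
  have sa: "?a \<omega> \<longleftrightarrow> ?a' \<omega>" if "\<omega> \<in> space P" "\<omega> \<inter> (?A \<inter> ?B) = {}" for \<omega>
  proof -
    \<comment> \<open>With no disc touching both strips, removing \<open>?B\<close> from
      \<open>?A\<close> removes no disc of the configuration.\<close>
    have eq: "\<omega> \<inter> (?A - ?B) = \<omega> \<inter> ?A" using that by blast
    show ?thesis
      unfolding eq by (rule hcross_cong) (rule restrict_touching[OF S that(1), symmetric])
  qed
  have sb: "?b \<omega> \<longleftrightarrow> ?b' \<omega>" if "\<omega> \<in> space P" "\<omega> \<inter> (?A \<inter> ?B) = {}" for \<omega>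
  proof -
    have eq: "\<omega> \<inter> (?B - ?A) = \<omega> \<inter> ?B" using that by blast
    show ?thesis
      unfolding eq by (rule hcross_cong) (rule restrict_touching[OF S that(1), symmetric])
  qed
  have fa: "pr (\<lambda>\<omega>. \<not> ?a \<omega>) \<le> 7 * fail S r"
    by (rule pr_strip_fail[OF r, where c = 0]) (use r in linarith)+
  have fb: "pr (\<lambda>\<omega>. \<not> ?b \<omega>) \<le> 7 * fail S r"
    by (rule pr_strip_fail[OF r, where c = 0]) (use r in linarith)+
  \<comment> \<open>The restricted crossing can fail while the full one holds only on
    \<open>?N\<close>, which costs another \<open>?e\<close>.\<close>
  have "pr (\<lambda>\<omega>. \<not> ?a' \<omega>) \<le> pr (\<lambda>\<omega>. \<not> ?a \<omega>) + pr ?N"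
  proof (rule pr_le_add)
    show "\<not> ?a \<omega> \<or> ?N \<omega>" if "\<omega> \<in> space P" "\<not> ?a' \<omega>" for \<omega>
      using sa[OF that(1)] that(2) by blast
    show "ev (\<lambda>\<omega>. \<not> ?a \<omega>)" using r by (intro ev_not ev_hcross) simp
  qed (rule evN)
  also have "\<dots> \<le> 7 * fail S r + ?e"
    by (rule add_mono[OF fa N])
  finally have a: "pr (\<lambda>\<omega>. \<not> ?a' \<omega>) \<le> 7 * fail S r + ?e" .
  have "pr (\<lambda>\<omega>. \<not> ?b' \<omega>) \<le> pr (\<lambda>\<omega>. \<not> ?b \<omega>) + pr ?N"
  proof (rule pr_le_add)
    show "\<not> ?b \<omega> \<or> ?N \<omega>" if "\<omega> \<in> space P" "\<not> ?b' \<omega>" for \<omega>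
      using sb[OF that(1)] that(2) by blast
    show "ev (\<lambda>\<omega>. \<not> ?b \<omega>)" using r by (intro ev_not ev_hcross) simp
  qed (rule evN)
  also have "\<dots> \<le> 7 * fail S r + ?e"
    by (rule add_mono[OF fb N])
  finally have b: "pr (\<lambda>\<omega>. \<not> ?b' \<omega>) \<le> 7 * fail S r + ?e" .
  have "fail S (3 * r) = pr (\<lambda>\<omega>. \<not> hcross (S \<omega>) 0 (3 * (3 * r)) 0 (3 * r))"
    unfolding fail_def using r by (subst pr_not) (auto intro!: ev_hcross)
  also have "\<dots> \<le> pr (\<lambda>\<omega>. \<not> ?a' \<omega> \<and> \<not> ?b' \<omega>) + pr ?N"
  proof (rule pr_le_add)
    fix \<omega> assume \<omega>: "\<omega> \<in> space P" and no: "\<not> hcross (S \<omega>) 0 (3 * (3 * r)) 0 (3 * r)"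
    have "\<not> ?a \<omega>"
      using no hcross_mono[of "S \<omega>" 0 "9 * r" 0 "0 + r" "S \<omega>" 0 "3 * r"] r by auto
    moreover have "\<not> ?b \<omega>"
      using no hcross_mono[of "S \<omega>" 0 "9 * r" "2 * r" "2 * r + r" "S \<omega>" 0 "3 * r"] r by auto
    ultimately show "(\<not> ?a' \<omega> \<and> \<not> ?b' \<omega>) \<or> ?N \<omega>"
      using sa[OF \<omega>] sb[OF \<omega>] by blast
  qed (intro ev_conj ev_not eva evb evN)+
  also have "pr (\<lambda>\<omega>. \<not> ?a' \<omega> \<and> \<not> ?b' \<omega>) = pr (\<lambda>\<omega>. \<not> ?a' \<omega>) * pr (\<lambda>\<omega>. \<not> ?b' \<omega>)"
    by (rule determined_indep[OF determined_not[OF deta] determined_not[OF detb]]) blast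
  also have "\<dots> \<le> (7 * fail S r + ?e) * (7 * fail S r + ?e)"
    using fail_nonneg[of S r] e0 by (intro mult_mono a b) (auto simp: pr_def)
  finally show ?thesis using N by (simp add: power2_eq_square)
qed

section \<open>Iteration over the scales\<close>

lemma fail_step:
  assumes "0 < r" "fail S r \<le> 1 / 200" "lam * tail r \<le> 1 / 800"
  shows "fail S (3 * r) \<le> fail S r / 2 + 2 * (lam * tail r)" "fail S (3 * r) \<le> 1 / 200"
proof -
  let ?f = "fail S r" and ?e = "lam * tail r"
  have nn: "0 \<le> ?f" "0 \<le> ?e" using fail_nonneg lam_nonneg tail_nonneg by auto
  \<comment> \<open>One factor is at most \<open>7 / 200 + 1 / 800 = 29 / 800\<close>, which is
    below \<open>1 / 20\<close>. The total is then at most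
    \<open>(7 / 20) * ?f + (21 / 20) * ?e\<close>.\<close>
  have "(7 * ?f + ?e)\<^sup>2 \<le> (1 / 20) * (7 * ?f + ?e)"
    unfolding power2_eq_square using nn assms by (intro mult_right_mono) auto
  then show "fail S (3 * r) \<le> ?f / 2 + 2 * ?e"
    using fail_renormalize[OF assms(1)] nn by simp
  \<comment> \<open>\<open>1 / 400 + 2 / 800\<close> is again \<open>1 / 200\<close>, so the
    smallness reproduces itself at the next scale.\<close>
  then show "fail S (3 * r) \<le> 1 / 200" using assms by simp
qed

lemma fail_geometric:
  assumes r: "0 < r" "fail S r \<le> 1 / 200" and e: "\<And>s. r \<le> s \<Longrightarrow> lam * tail s \<le> 1 / 800"
  shows "fail S (3 ^ k * r) \<le> 1 / 200" "fail S (3 ^ Suc k * r) \<le> fail S (3 ^ k * r) / 2 + 2 * (lam * tail (3 ^ k * r))"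
proof -
  have pos: "0 < 3 ^ k * r" "r \<le> 3 ^ k * r" for k
    using r(1) one_le_power[of "3::real" k] by (simp_all add: mult_le_cancel_right1)
  show small: "fail S (3 ^ k * r) \<le> 1 / 200" for k
  proof (induction k)
    case (Suc k)
    show ?case using fail_step(2)[OF pos(1) Suc e[OF pos(2)]] by (simp add: mult.assoc)
  qed (use r in simp)
  show "fail S (3 ^ Suc k * r) \<le> fail S (3 ^ k * r) / 2 + 2 * (lam * tail (3 ^ k * r))"
    using fail_step(1)[OF pos(1) small e[OF pos(2)], of k] by (simp add: mult.assoc)
qed

text \<open>The halving recurrence gives the limit along the scales \<open>3 ^ k * r\<close>;
  \<open>fail_interpolate\<close> extends it to all scales at the cost of a factor 7, hence the
  choice of \<open>\<epsilon> / 7\<close>.\<close>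

lemma fail_tendsto_0:
  assumes r: "0 < r" "fail S r \<le> 1 / 200" and e: "\<And>s. r \<le> s \<Longrightarrow> lam * tail s \<le> 1 / 800"
  shows "(fail S \<longlongrightarrow> 0) at_top"
proof -
  have "(\<lambda>k. 2 * (lam * tail (3 ^ k * r))) \<longlonglongrightarrow> 2 * (lam * 0)"
    by (intro tendsto_intros filterlim_compose[OF tail_tendsto_0 filterlim_geometric[OF r(1)]])
  moreover have step: "fail S (3 ^ Suc k * r) \<le> fail S (3 ^ k * r) / 2 + 2 * (lam * tail (3 ^ k * r))" for k
    by (rule fail_geometric(2)[OF r]) (rule e)
  ultimately have lim: "(\<lambda>k. fail S (3 ^ k * r)) \<longlonglongrightarrow> 0"
    by (intro tendsto_0_perturbed_halving[where a = "\<lambda>k. fail S (3 ^ k * r)" and b = "\<lambda>k. 2 * (lam * tail (3 ^ k * r))"]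
        fail_nonneg step) simp
  show ?thesis
  proof (rule tendstoI)
    fix \<epsilon> :: real assume "0 < \<epsilon>"
    then obtain N where N: "\<And>k. N \<le> k \<Longrightarrow> norm (fail S (3 ^ k * r) - 0) < \<epsilon> / 7"
      using LIMSEQ_D[OF lim, of "\<epsilon> / 7"] by auto
    have "dist (fail S s) 0 < \<epsilon>" if s: "3 ^ N * r \<le> s" for s
    proof -
      \<comment> \<open>With the least such \<open>k\<close>, its predecessor \<open>j\<close>
        satisfies \<open>3 ^ j * r \<le> s < 3 ^ Suc j * r\<close>.\<close>
      have "\<exists>k. s < 3 ^ k * r"
        using filterlim_geometric[OF r(1)] by (auto simp: filterlim_at_top_dense eventually_sequentially)
      then obtain k where k: "s < 3 ^ k * r" "\<And>j. j < k \<Longrightarrow> \<not> s < 3 ^ j * r"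
        using exists_least_iff[of "\<lambda>k. s < 3 ^ k * r"] by blast
      have "N < k"
      proof (rule ccontr)
        assume "\<not> N < k"
        then have "3 ^ k * r \<le> 3 ^ N * r" using r(1) by simp
        with s k(1) show False by simp
      qed
      then obtain j where j: "k = Suc j" "N \<le> j" by (cases k) auto
      have "fail S s \<le> 7 * fail S (3 ^ j * r)"
        using k(1) k(2)[of j] r(1) j by (intro fail_interpolate) auto
      also have "\<dots> < \<epsilon>" using N[OF j(2)] by simp
      finally show ?thesis using fail_nonneg[of S s] by simp
    qed
    then show "\<forall>\<^sub>F s in at_top. dist (fail S s) 0 < \<epsilon>"
      unfolding eventually_at_top_linorder by blast
  qed
qed

lemma fail_summable:
  assumes lim: "(fail S \<longlongrightarrow> 0) at_top" and int: "integrable mu (\<lambda>x. x\<^sup>2 * ln x)"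
  shows "summable (\<lambda>k. fail S (3 ^ k))"
proof -
  have "((\<lambda>r. lam * tail r) \<longlongrightarrow> lam * 0) at_top"
    by (intro tendsto_intros tail_tendsto_0)
  then have "\<forall>\<^sub>F r in at_top. lam * tail r < 1 / 800"
    by (intro order_tendstoD) auto
  moreover have "\<forall>\<^sub>F r in at_top. fail S r < 1 / 200"
    using lim by (rule order_tendstoD) simp
  ultimately have "\<forall>\<^sub>F r in at_top. lam * tail r < 1 / 800 \<and> fail S r < 1 / 200"
    by (rule eventually_conj)
  then obtain R where R: "\<And>r. R \<le> r \<Longrightarrow> lam * tail r < 1 / 800 \<and> fail S r < 1 / 200"
    unfolding eventually_at_top_linorder by blast
  \<comment> \<open>Starting the iteration at a power of 3 keeps it on the scales of the series,
    which it then covers up to a shift by \<open>n\<close>.\<close>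
  obtain n where n: "R < 3 ^ n" using real_arch_pow[of 3 R] by auto
  let ?r = "3 ^ n :: real"
  have "summable (\<lambda>k. 2 * (lam * tail (3 ^ k)))"
    by (intro summable_mult summable_tail int)
  then have "summable (\<lambda>k. 2 * (lam * tail (3 ^ (k + n))))"
    by (rule summable_ignore_initial_segment)
  then have "summable (\<lambda>k. 2 * (lam * tail (3 ^ k * ?r)))"
    by (simp add: power_add)
  moreover have "fail S ?r \<le> 1 / 200" "\<And>s. ?r \<le> s \<Longrightarrow> lam * tail s \<le> 1 / 800"
    using R n by (force intro: less_imp_le)+
  then have "fail S (3 ^ Suc k * ?r) \<le> fail S (3 ^ k * ?r) / 2 + 2 * (lam * tail (3 ^ k * ?r))" for k
    by (intro fail_geometric) auto
  moreover have "0 \<le> 2 * (lam * tail (3 ^ k * ?r))" for k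
    using lam_nonneg tail_nonneg by simp
  ultimately have "summable (\<lambda>k. fail S (3 ^ k * ?r))"
    by (intro summable_perturbed_halving[where a = "\<lambda>k. fail S (3 ^ k * ?r)" and b = "\<lambda>k. 2 * (lam * tail (3 ^ k * ?r))"]
        fail_nonneg)
  then have "summable (\<lambda>k. fail S (3 ^ (k + n)))"
    by (simp add: power_add)
  then show ?thesis by (rule summable_iff_shift[THEN iffD1])
qed

end

lemma Pr_crossed: "Pr P {\<omega>. crossed (S \<omega>) a h} = pr (\<lambda>\<omega>. hcross (S \<omega>) 0 a 0 h)"
  unfolding Pr_def pr_def crossed_eq_hcross by (rule arg_cong[where f = "measure (completion P)"]) auto

lemma Pr_Cross:
  assumes "C \<in> {Cross, Cross_star}"
  obtains S where "S \<in> {occupied, vacant}" "\<And>r. Pr P (C (3 * r) r) = 1 - fail S r"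
proof -
  obtain S where S: "S \<in> {occupied, vacant}" "\<And>a h. C a h = {\<omega>. crossed (S \<omega>) a h}"
    using assms unfolding Cross_def[abs_def] Cross_star_def[abs_def] by blast
  show thesis
    by (rule that[OF S(1)]) (simp add: S(2) Pr_crossed fail_def)
qed

end

section \<open>The threshold scale\<close>

context radius_law
begin

text \<open>The summand 1 is there because the infimum need not be attained.\<close>
definition threshold :: "real \<Rightarrow> real" where
  "threshold lam = Inf {r. 0 \<le> r \<and> lam * tail r \<le> 1 / 800} + 1"

lemma threshold_set:
  "{r. 0 \<le> r \<and> lam * tail r \<le> 1 / 800} \<noteq> {}" "bdd_below {r. 0 \<le> r \<and> lam * tail r \<le> 1 / 800}"
proof -
  have "((\<lambda>r. lam * tail r) \<longlongrightarrow> lam * 0) at_top"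
    by (intro tendsto_intros tail_tendsto_0)
  then have "\<forall>\<^sub>F r in at_top. lam * tail r < 1 / 800"
    by (intro order_tendstoD) auto
  then have "\<forall>\<^sub>F r in at_top. lam * tail r < 1 / 800 \<and> 0 \<le> r"
    using eventually_ge_at_top by (rule eventually_conj)
  then obtain r where "lam * tail r < 1 / 800" "0 \<le> r"
    unfolding eventually_at_top_linorder by blast
  then have "r \<in> {r. 0 \<le> r \<and> lam * tail r \<le> 1 / 800}" by simp
  then show "{r. 0 \<le> r \<and> lam * tail r \<le> 1 / 800} \<noteq> {}" by blast
  show "bdd_below {r. 0 \<le> r \<and> lam * tail r \<le> 1 / 800}" by (rule bdd_belowI[of _ 0]) auto
qed

lemma threshold_nonneg: "0 \<le> threshold lam"
proof -
  have "0 \<le> Inf {r. 0 \<le> r \<and> lam * tail r \<le> 1 / 800}"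
    by (rule cInf_greatest[OF threshold_set(1)]) auto
  then show ?thesis unfolding threshold_def by simp
qed

text \<open>Raising \<open>lam\<close> shrinks the set of admissible scales and so raises its
  infimum.\<close>

lemma threshold_mono: "mono_on {0..} threshold"
proof (rule mono_onI)
  fix lam lam' :: real assume "lam \<le> lam'"
  have "{r. 0 \<le> r \<and> lam' * tail r \<le> 1 / 800} \<subseteq> {r. 0 \<le> r \<and> lam * tail r \<le> 1 / 800}"
    using order_trans[OF mult_right_mono[OF \<open>lam \<le> lam'\<close> tail_nonneg]] by blast
  then show "threshold lam \<le> threshold lam'"
    unfolding threshold_def by (intro add_right_mono cInf_superset_mono threshold_set)
qed

text \<open>Some admissible scale lies strictly below \<open>r\<close>, and \<open>tail\<close> is
  decreasing.\<close>

lemma beyond_threshold: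
  assumes "0 \<le> lam" "threshold lam \<le> r"
  shows "lam * tail r \<le> 1 / 800"
proof -
  have "Inf {r. 0 \<le> r \<and> lam * tail r \<le> 1 / 800} < r"
    using assms(2) unfolding threshold_def by simp
  then obtain s where "lam * tail s \<le> 1 / 800" "s < r"
    using cInf_lessD[OF threshold_set(1)] by blast
  then show ?thesis
    using mult_left_mono[OF tail_antimono[of s r] assms(1)] by simp
qed

end

text \<open>The witness for \<open>\<theta>\<close> is \<open>1 / 200\<close> whatever
  \<open>mu\<close> is, and \<open>r0\<close> is \<open>threshold\<close>. As
  \<open>x^2 * ln x\<close> is bounded on \<open>[0, 1]\<close>, its integrability constrains large
  radii only.\<close>

theorem proposition3p1:
  fixes mu :: "real measure"
  assumes "prob_space mu"
    and "sets mu = sets (restrict_space borel {0..})"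
    and "integrable mu (\<lambda>x. x^2)"
  shows "\<exists>\<theta>>0. \<exists>r0 :: real \<Rightarrow> real.
    mono_on {0..} r0 \<and> (\<forall>lam\<ge>0. r0 lam \<ge> 0) \<and>
    (\<forall>lam\<ge>0. \<forall>P. poisson_law (intensity lam mu) P \<longrightarrow>
      (\<forall>C \<in> {Cross, Cross_star}.
        ((\<exists>r>0. r \<ge> r0 lam \<and> Pr P (C (3 * r) r) > 1 - \<theta>) \<longleftrightarrow>
         ((\<lambda>r. Pr P (C (3 * r) r)) \<longlongrightarrow> 1) at_top) \<and>
        (integrable mu (\<lambda>x. x^2 * ln x) \<longrightarrow>
         (\<exists>r>0. r \<ge> r0 lam \<and> Pr P (C (3 * r) r) > 1 - \<theta>) \<or>
         ((\<lambda>r. Pr P (C (3 * r) r)) \<longlongrightarrow> 1) at_top \<longrightarrow>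
         summable (\<lambda>k::nat. 1 - Pr P (C (3 ^ (k + 1)) (3 ^ k))))))"
proof -
  interpret radius_law mu
    by (intro radius_law.intro radius_law_axioms.intro assms)
  have main: "((\<exists>r>0. r \<ge> threshold lam \<and> Pr P (C (3 * r) r) > 1 - 1 / 200) \<longleftrightarrow>
         ((\<lambda>r. Pr P (C (3 * r) r)) \<longlongrightarrow> 1) at_top) \<and>
        (integrable mu (\<lambda>x. x^2 * ln x) \<longrightarrow>
         (\<exists>r>0. r \<ge> threshold lam \<and> Pr P (C (3 * r) r) > 1 - 1 / 200) \<or>
         ((\<lambda>r. Pr P (C (3 * r) r)) \<longlongrightarrow> 1) at_top \<longrightarrow>
         summable (\<lambda>k::nat. 1 - Pr P (C (3 ^ (k + 1)) (3 ^ k))))"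
    if lam: "0 \<le> lam" and P: "poisson_law (intensity lam mu) P" and C: "C \<in> {Cross, Cross_star}" for lam P C
  proof -
    interpret prob_space P using P by (simp add: poisson_law_def)
    interpret boolean_model mu P lam
      by (intro boolean_model.intro boolean_model_axioms.intro lam P) unfold_locales
    obtain S where S: "S \<in> {occupied, vacant}" and Pr: "\<And>r. Pr P (C (3 * r) r) = 1 - fail S r"
      using Pr_Cross[OF C] by blast
    have lim: "((\<lambda>r. Pr P (C (3 * r) r)) \<longlongrightarrow> 1) at_top \<longleftrightarrow> (fail S \<longlongrightarrow> 0) at_top"
    proof
      assume "((\<lambda>r. Pr P (C (3 * r) r)) \<longlongrightarrow> 1) at_top"
      then have "((\<lambda>r. 1 - Pr P (C (3 * r) r)) \<longlongrightarrow> 1 - 1) at_top" by (intro tendsto_intros)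
      then show "(fail S \<longlongrightarrow> 0) at_top" by (simp add: Pr)
    next
      assume "(fail S \<longlongrightarrow> 0) at_top"
      then have "((\<lambda>r. 1 - fail S r) \<longlongrightarrow> 1 - 0) at_top" by (intro tendsto_intros)
      then show "((\<lambda>r. Pr P (C (3 * r) r)) \<longlongrightarrow> 1) at_top" by (simp add: Pr)
    qed
    have "(fail S \<longlongrightarrow> 0) at_top" if "0 < r" "threshold lam \<le> r" "1 - fail S r > 1 - 1 / 200" for r
      using that lam by (intro fail_tendsto_0[OF S, of r] beyond_threshold) auto
    moreover have "\<exists>r>0. threshold lam \<le> r \<and> 1 - fail S r > 1 - 1 / 200" if "(fail S \<longlongrightarrow> 0) at_top"
    proof -
      have "\<forall>\<^sub>F r in at_top. fail S r < 1 / 200"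
        using that by (rule order_tendstoD) simp
      then have "\<forall>\<^sub>F r in at_top. fail S r < 1 / 200 \<and> 0 < r \<and> threshold lam \<le> r"
        by (intro eventually_conj eventually_gt_at_top eventually_ge_at_top)
      then obtain r where "fail S r < 1 / 200" "0 < r" "threshold lam \<le> r"
        unfolding eventually_at_top_linorder by blast
      then show ?thesis by (intro exI[of _ r]) auto
    qed
    ultimately have iff: "(\<exists>r>0. r \<ge> threshold lam \<and> Pr P (C (3 * r) r) > 1 - 1 / 200) \<longleftrightarrow>
        ((\<lambda>r. Pr P (C (3 * r) r)) \<longlongrightarrow> 1) at_top"
      unfolding lim unfolding Pr by blast
    have "summable (\<lambda>k::nat. 1 - Pr P (C (3 ^ (k + 1)) (3 ^ k)))"
      if "integrable mu (\<lambda>x. x\<^sup>2 * ln x)" "((\<lambda>r. Pr P (C (3 * r) r)) \<longlongrightarrow> 1) at_top"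
    proof -
      have "1 - Pr P (C (3 ^ (k + 1)) (3 ^ k)) = fail S (3 ^ k)" for k
        using Pr[of "3 ^ k"] by simp
      then show ?thesis
        using fail_summable[OF S] that lim by simp
    qed
    \<comment> \<open>By \<open>iff\<close> either alternative in the summability claim amounts to
      the limit.\<close>
    then show ?thesis
      unfolding iff by simp
  qed
  show ?thesis
  proof (intro exI[of _ "1 / 200"] exI[of _ threshold] conjI)
    show "mono_on {0..} threshold" by (rule threshold_mono)
    show "\<forall>lam\<ge>0. 0 \<le> threshold lam" using threshold_nonneg by blast
    show "(0::real) < 1 / 200" by simp
  qed (intro allI impI ballI, rule main)
qed

end
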